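(* Let $\mathcal{C}$ be a finitely complete category with coequalizers and finite coproducts in which regular epimorphisms are closed under composition, let $n$ be a natural number, and let $H\colon\mathcal{C}^n\to\mathcal{C}^n$ be a monomorphism-preserving functor. If $\mathcal{C}$ is extensive, then the lifting $\bar{\textstyle\coprod}$ of the coproduct functor $\coprod$, $$\bar{\textstyle\coprod}\colon\mathsf{Coalg}(H\Delta\textstyle\coprod)\to\mathsf{Coalg}(\coprod H\Delta),\qquad\bar{\textstyle\coprod}\big(X\xrightarrow{\xi}H\Delta\coprod X\big)=\big(\coprod X\xrightarrow{\coprod\xi}\coprod H\Delta\coprod X\big),$$ is an equivalence of categories.
   Context: $\Delta\colon\mathcal{C}\to\mathcal{C}^n$, $\Delta(X)=(X,\dots,X)$, is the diagonal functor, with left adjoint $\coprod\colon\mathcal{C}^n\to\mathcal{C}$, $\coprod(X_1,\dots,X_n)=X_1+\dots+X_n$. For an endofunctor $F$ on a category $\mathcal{D}$, $\mathsf{Coalg}(F)$ is the category of $F$-coalgebras $\xi\colon X\to FX$ with morphisms $h\colon(X,\xi)\to(Y,\zeta)$ those $h\colon X\to Y$ in $\mathcal{D}$ with $\zeta\cdot h=Fh\cdot\xi$. Thus $H\Delta\coprod$-coalgebras live in $\mathcal{C}^n$ and $\coprod H\Delta$-coalgebras live in $\mathcal{C}$; on morphisms, $\bar\coprod$ acts as $\coprod$. A category $\mathcal{C}$ with finite coproducts is extensive if for all objects $Y_1,Y_2$ the canonical functor $\mathcal{C}/Y_1\times\mathcal{C}/Y_2\to\mathcal{C}/(Y_1+Y_2)$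 is an equivalence of categories. *)

theory Defs
  imports "HOL-Library.FuncSet"
begin

section \<open>Categories and functors\<close>

record ('o, 'm) cat =
  Obj :: "'o set"
  Arr :: "'m set"
  Dom :: "'m \<Rightarrow> 'o"
  Cod :: "'m \<Rightarrow> 'o"
  Id :: "'o \<Rightarrow> 'm"
  Comp :: "'m \<Rightarrow> 'm \<Rightarrow> 'm" (infixl "\<cdot>\<index>" 70)

definition Hom :: "('o, 'm) cat \<Rightarrow> 'o \<Rightarrow> 'o \<Rightarrow> 'm set" where
  "Hom C X Y = {f \<in> Arr C. Dom C f = X \<and> Cod C f = Y}"

definition category :: "('o, 'm) cat \<Rightarrow> bool" where
  "category C \<longleftrightarrow>
     (\<forall>f\<in>Arr C. Dom C f \<in> Obj C \<and> Cod C f \<in> Obj C) \<and>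
     (\<forall>X\<in>Obj C. Id C X \<in> Hom C X X) \<and>
     (\<forall>f\<in>Arr C. \<forall>g\<in>Arr C. Cod C f = Dom C g \<longrightarrow> g \<cdot>\<^bsub>C\<^esub> f \<in> Hom C (Dom C f) (Cod C g)) \<and>
     (\<forall>f\<in>Arr C. f \<cdot>\<^bsub>C\<^esub> Id C (Dom C f) = f \<and> Id C (Cod C f) \<cdot>\<^bsub>C\<^esub> f = f) \<and>
     (\<forall>f\<in>Arr C. \<forall>g\<in>Arr C. \<forall>h\<in>Arr C. Cod C f = Dom C g \<and> Cod C g = Dom C h \<longrightarrow>
        h \<cdot>\<^bsub>C\<^esub> (g \<cdot>\<^bsub>C\<^esub> f) = (h \<cdot>\<^bsub>C\<^esub> g) \<cdot>\<^bsub>C\<^esub> f)"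

definition iso :: "('o, 'm) cat \<Rightarrow> 'm \<Rightarrow> bool" where
  "iso C f \<longleftrightarrow> f \<in> Arr C \<and>
     (\<exists>g\<in>Hom C (Cod C f) (Dom C f). g \<cdot>\<^bsub>C\<^esub> f = Id C (Dom C f) \<and> f \<cdot>\<^bsub>C\<^esub> g = Id C (Cod C f))"

definition monic :: "('o, 'm) cat \<Rightarrow> 'm \<Rightarrow> bool" where
  "monic C f \<longleftrightarrow> f \<in> Arr C \<and>
     (\<forall>X\<in>Obj C. \<forall>u\<in>Hom C X (Dom C f). \<forall>v\<in>Hom C X (Dom C f).
        f \<cdot>\<^bsub>C\<^esub> u = f \<cdot>\<^bsub>C\<^esub> v \<longrightarrow> u = v)"

record ('o1, 'm1, 'o2, 'm2) func =
  Fobj :: "'o1 \<Rightarrow> 'o2"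
  Farr :: "'m1 \<Rightarrow> 'm2"

definition is_functor ::
  "('o1, 'm1) cat \<Rightarrow> ('o2, 'm2) cat \<Rightarrow> ('o1, 'm1, 'o2, 'm2) func \<Rightarrow> bool" where
  "is_functor C D F \<longleftrightarrow>
     (\<forall>X\<in>Obj C. Fobj F X \<in> Obj D) \<and>
     (\<forall>f\<in>Arr C. Farr F f \<in> Hom D (Fobj F (Dom C f)) (Fobj F (Cod C f))) \<and>
     (\<forall>X\<in>Obj C. Farr F (Id C X) = Id D (Fobj F X)) \<and>
     (\<forall>f\<in>Arr C. \<forall>g\<in>Arr C. Cod C f = Dom C g \<longrightarrow>
        Farr F (g \<cdot>\<^bsub>C\<^esub> f) = Farr F g \<cdot>\<^bsub>D\<^esub> Farr F f)"

definition id_func :: "('o, 'm, 'o, 'm) func" where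
  "id_func = \<lparr>Fobj = (\<lambda>X. X), Farr = (\<lambda>f. f)\<rparr>"

definition comp_func ::
  "('o2, 'm2, 'o3, 'm3) func \<Rightarrow> ('o1, 'm1, 'o2, 'm2) func \<Rightarrow> ('o1, 'm1, 'o3, 'm3) func"
  (infixl "\<circ>\<^sub>F" 55) where
  "G \<circ>\<^sub>F F = \<lparr>Fobj = (\<lambda>X. Fobj G (Fobj F X)), Farr = (\<lambda>f. Farr G (Farr F f))\<rparr>"

definition nat_iso ::
  "('o1, 'm1) cat \<Rightarrow> ('o2, 'm2) cat \<Rightarrow> ('o1, 'm1, 'o2, 'm2) func \<Rightarrow> ('o1, 'm1, 'o2, 'm2) func
     \<Rightarrow> ('o1 \<Rightarrow> 'm2) \<Rightarrow> bool" where
  "nat_iso C D F G \<eta> \<longleftrightarrow>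
     (\<forall>X\<in>Obj C. \<eta> X \<in> Hom D (Fobj F X) (Fobj G X) \<and> iso D (\<eta> X)) \<and>
     (\<forall>f\<in>Arr C. \<eta> (Cod C f) \<cdot>\<^bsub>D\<^esub> Farr F f = Farr G f \<cdot>\<^bsub>D\<^esub> \<eta> (Dom C f))"

definition is_equivalence ::
  "('o1, 'm1) cat \<Rightarrow> ('o2, 'm2) cat \<Rightarrow> ('o1, 'm1, 'o2, 'm2) func \<Rightarrow> bool" where
  "is_equivalence C D F \<longleftrightarrow> is_functor C D F \<and>
     (\<exists>G. is_functor D C G \<and>
        (\<exists>\<eta>. nat_iso C C id_func (G \<circ>\<^sub>F F) \<eta>) \<and>
        (\<exists>\<epsilon>. nat_iso D D (F \<circ>\<^sub>F G) id_func \<epsilon>))"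

section \<open>Limits, coequalizers and regular epimorphisms\<close>

definition cone ::
  "('j, 'k) cat \<Rightarrow> ('o, 'm) cat \<Rightarrow> ('j, 'k, 'o, 'm) func \<Rightarrow> 'o \<Rightarrow> ('j \<Rightarrow> 'm) \<Rightarrow> bool" where
  "cone J C D L p \<longleftrightarrow> L \<in> Obj C \<and>
     (\<forall>j\<in>Obj J. p j \<in> Hom C L (Fobj D j)) \<and>
     (\<forall>u\<in>Arr J. Farr D u \<cdot>\<^bsub>C\<^esub> p (Dom J u) = p (Cod J u))"

definition limit_cone ::
  "('j, 'k) cat \<Rightarrow> ('o, 'm) cat \<Rightarrow> ('j, 'k, 'o, 'm) func \<Rightarrow> 'o \<Rightarrow> ('j \<Rightarrow> 'm) \<Rightarrow> bool" where
  "limit_cone J C D L p \<longleftrightarrow> cone J C D L p \<and>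
     (\<forall>M q. cone J C D M q \<longrightarrow> (\<exists>!h. h \<in> Hom C M L \<and> (\<forall>j\<in>Obj J. p j \<cdot>\<^bsub>C\<^esub> h = q j)))"

text \<open>Every finite category is isomorphic to one whose objects and arrows are natural numbers,
  so it suffices to let the index categories range over those.\<close>

definition finitely_complete :: "('o, 'm) cat \<Rightarrow> bool" where
  "finitely_complete C \<longleftrightarrow>
     (\<forall>(J :: (nat, nat) cat) D. category J \<and> finite (Obj J) \<and> finite (Arr J) \<and> is_functor J C D
        \<longrightarrow> (\<exists>L p. limit_cone J C D L p))"

definition is_coequalizer :: "('o, 'm) cat \<Rightarrow> 'm \<Rightarrow> 'm \<Rightarrow> 'm \<Rightarrow> bool" where
  "is_coequalizer C f g e \<longleftrightarrow>
     f \<in> Arr C \<and> g \<in> Hom C (Dom C f) (Cod C f) \<and>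
     e \<in> Arr C \<and> Dom C e = Cod C f \<and> e \<cdot>\<^bsub>C\<^esub> f = e \<cdot>\<^bsub>C\<^esub> g \<and>
     (\<forall>k\<in>Arr C. Dom C k = Cod C f \<and> k \<cdot>\<^bsub>C\<^esub> f = k \<cdot>\<^bsub>C\<^esub> g \<longrightarrow>
        (\<exists>!h. h \<in> Hom C (Cod C e) (Cod C k) \<and> h \<cdot>\<^bsub>C\<^esub> e = k))"

definition has_coequalizers :: "('o, 'm) cat \<Rightarrow> bool" where
  "has_coequalizers C \<longleftrightarrow>
     (\<forall>f\<in>Arr C. \<forall>g\<in>Hom C (Dom C f) (Cod C f). \<exists>e. is_coequalizer C f g e)"

definition regular_epi :: "('o, 'm) cat \<Rightarrow> 'm \<Rightarrow> bool" where
  "regular_epi C e \<longleftrightarrow> (\<exists>f g. is_coequalizer C f g e)"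

definition regular_epis_closed_under_composition :: "('o, 'm) cat \<Rightarrow> bool" where
  "regular_epis_closed_under_composition C \<longleftrightarrow>
     (\<forall>e d. regular_epi C e \<and> regular_epi C d \<and> Cod C e = Dom C d \<longrightarrow> regular_epi C (d \<cdot>\<^bsub>C\<^esub> e))"

definition preserves_monos ::
  "('o1, 'm1) cat \<Rightarrow> ('o2, 'm2) cat \<Rightarrow> ('o1, 'm1, 'o2, 'm2) func \<Rightarrow> bool" where
  "preserves_monos C D F \<longleftrightarrow> (\<forall>f. monic C f \<longrightarrow> monic D (Farr F f))"

section \<open>Powers of a category, diagonal and coproduct functors\<close>

text \<open>Objects and arrows of the \<open>n\<close>-th power are families indexed by \<open>{..<n}\<close>. They are required
  to be extensional (\<open>undefined\<close> outside the index set), so that equality of families is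
  componentwise equality. For \<open>n = 0\<close> this is the terminal category.\<close>

definition power_cat :: "('o, 'm) cat \<Rightarrow> nat \<Rightarrow> (nat \<Rightarrow> 'o, nat \<Rightarrow> 'm) cat" where
  "power_cat C n =
     \<lparr>Obj = {..<n} \<rightarrow>\<^sub>E Obj C,
      Arr = {..<n} \<rightarrow>\<^sub>E Arr C,
      Dom = (\<lambda>f. \<lambda>i\<in>{..<n}. Dom C (f i)),
      Cod = (\<lambda>f. \<lambda>i\<in>{..<n}. Cod C (f i)),
      Id = (\<lambda>X. \<lambda>i\<in>{..<n}. Id C (X i)),
      Comp = (\<lambda>g f. \<lambda>i\<in>{..<n}. g i \<cdot>\<^bsub>C\<^esub> f i)\<rparr>"

definition diag_func :: "nat \<Rightarrow> ('o, 'm, nat \<Rightarrow> 'o, nat \<Rightarrow> 'm) func" where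
  "diag_func n = \<lparr>Fobj = (\<lambda>X. \<lambda>i\<in>{..<n}. X), Farr = (\<lambda>f. \<lambda>i\<in>{..<n}. f)\<rparr>"

definition is_coproduct ::
  "('o, 'm) cat \<Rightarrow> nat \<Rightarrow> (nat \<Rightarrow> 'o) \<Rightarrow> 'o \<Rightarrow> (nat \<Rightarrow> 'm) \<Rightarrow> bool" where
  "is_coproduct C n X S \<iota> \<longleftrightarrow> S \<in> Obj C \<and> (\<forall>i<n. \<iota> i \<in> Hom C (X i) S) \<and>
     (\<forall>Y\<in>Obj C. \<forall>f. (\<forall>i<n. f i \<in> Hom C (X i) Y) \<longrightarrow>
        (\<exists>!h. h \<in> Hom C S Y \<and> (\<forall>i<n. h \<cdot>\<^bsub>C\<^esub> \<iota> i = f i)))"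

text \<open>A choice of finite coproducts: \<open>P n X\<close> is the coproduct of the family \<open>X\<close> indexed by
  \<open>{..<n}\<close>, with injections \<open>\<iota> n X i\<close>. Such a choice exists iff all finite coproducts exist.\<close>

definition finite_coproducts ::
  "('o, 'm) cat \<Rightarrow> (nat \<Rightarrow> (nat \<Rightarrow> 'o) \<Rightarrow> 'o) \<Rightarrow> (nat \<Rightarrow> (nat \<Rightarrow> 'o) \<Rightarrow> nat \<Rightarrow> 'm) \<Rightarrow> bool" where
  "finite_coproducts C P \<iota> \<longleftrightarrow>
     (\<forall>n. \<forall>X\<in>Obj (power_cat C n). is_coproduct C n X (P n X) (\<iota> n X))"

definition coprod_func ::
  "('o, 'm) cat \<Rightarrow> (nat \<Rightarrow> (nat \<Rightarrow> 'o) \<Rightarrow> 'o) \<Rightarrow> (nat \<Rightarrow> (nat \<Rightarrow> 'o) \<Rightarrow> nat \<Rightarrow> 'm) \<Rightarrow> nat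
     \<Rightarrow> (nat \<Rightarrow> 'o, nat \<Rightarrow> 'm, 'o, 'm) func" where
  "coprod_func C P \<iota> n =
     \<lparr>Fobj = P n,
      Farr = (\<lambda>f. let X = Dom (power_cat C n) f; Y = Cod (power_cat C n) f in
        THE h. h \<in> Hom C (P n X) (P n Y) \<and> (\<forall>i<n. h \<cdot>\<^bsub>C\<^esub> \<iota> n X i = \<iota> n Y i \<cdot>\<^bsub>C\<^esub> f i))\<rparr>"

section \<open>Extensive categories\<close>

definition prod_cat :: "('o1, 'm1) cat \<Rightarrow> ('o2, 'm2) cat \<Rightarrow> ('o1 \<times> 'o2, 'm1 \<times> 'm2) cat" where
  "prod_cat C D =
     \<lparr>Obj = Obj C \<times> Obj D,
      Arr = Arr C \<times> Arr D,
      Dom = (\<lambda>(f, g). (Dom C f, Dom D g)),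
      Cod = (\<lambda>(f, g). (Cod C f, Cod D g)),
      Id = (\<lambda>(X, Y). (Id C X, Id D Y)),
      Comp = (\<lambda>(f', g') (f, g). (f' \<cdot>\<^bsub>C\<^esub> f, g' \<cdot>\<^bsub>D\<^esub> g))\<rparr>"

text \<open>An arrow of the slice from \<open>f\<close> to \<open>g\<close> is a triple \<open>(f, g, h)\<close>: since an arrow
  must determine its domain and codomain, the underlying \<open>h\<close> alone does not suffice.
  The same applies to coalgebra morphisms below.\<close>

definition slice :: "('o, 'm) cat \<Rightarrow> 'o \<Rightarrow> ('m, 'm \<times> 'm \<times> 'm) cat" where
  "slice C Y =
     \<lparr>Obj = {f \<in> Arr C. Cod C f = Y},
      Arr = {(f, g, h). f \<in> Arr C \<and> Cod C f = Y \<and> g \<in> Arr C \<and> Cod C g = Y \<and>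
               h \<in> Hom C (Dom C f) (Dom C g) \<and> g \<cdot>\<^bsub>C\<^esub> h = f},
      Dom = (\<lambda>(f, g, h). f),
      Cod = (\<lambda>(f, g, h). g),
      Id = (\<lambda>f. (f, f, Id C (Dom C f))),
      Comp = (\<lambda>(f', g', h') (f, g, h). (f, g', h' \<cdot>\<^bsub>C\<^esub> h))\<rparr>"

definition pair :: "'a \<Rightarrow> 'a \<Rightarrow> nat \<Rightarrow> 'a" where
  "pair a b = (\<lambda>i\<in>{..<2}. if i = 0 then a else b)"

definition slice_coprod_func ::
  "('o, 'm) cat \<Rightarrow> (nat \<Rightarrow> (nat \<Rightarrow> 'o) \<Rightarrow> 'o) \<Rightarrow> (nat \<Rightarrow> (nat \<Rightarrow> 'o) \<Rightarrow> nat \<Rightarrow> 'm)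
     \<Rightarrow> ('m \<times> 'm, ('m \<times> 'm \<times> 'm) \<times> ('m \<times> 'm \<times> 'm), 'm, 'm \<times> 'm \<times> 'm) func" where
  "slice_coprod_func C P \<iota> =
     (let plus = (\<lambda>f1 f2. Farr (coprod_func C P \<iota> 2) (pair f1 f2)) in
      \<lparr>Fobj = (\<lambda>(f1, f2). plus f1 f2),
       Farr = (\<lambda>((f1, g1, h1), (f2, g2, h2)). (plus f1 f2, plus g1 g2, plus h1 h2))\<rparr>)"

definition extensive ::
  "('o, 'm) cat \<Rightarrow> (nat \<Rightarrow> (nat \<Rightarrow> 'o) \<Rightarrow> 'o) \<Rightarrow> (nat \<Rightarrow> (nat \<Rightarrow> 'o) \<Rightarrow> nat \<Rightarrow> 'm) \<Rightarrow> bool" where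
  "extensive C P \<iota> \<longleftrightarrow>
     (\<forall>Y1\<in>Obj C. \<forall>Y2\<in>Obj C.
        is_equivalence (prod_cat (slice C Y1) (slice C Y2)) (slice C (P 2 (pair Y1 Y2)))
          (slice_coprod_func C P \<iota>))"

section \<open>Coalgebras\<close>

definition coalg :: "('o, 'm) cat \<Rightarrow> ('o, 'm, 'o, 'm) func
    \<Rightarrow> ('o \<times> 'm, ('o \<times> 'm) \<times> ('o \<times> 'm) \<times> 'm) cat" where
  "coalg D F =
     (let Ob = {(X, \<xi>). X \<in> Obj D \<and> \<xi> \<in> Hom D X (Fobj F X)} in
      \<lparr>Obj = Ob,
       Arr = {((X, \<xi>), (Y, \<zeta>), h). (X, \<xi>) \<in> Ob \<and> (Y, \<zeta>) \<in> Ob \<and>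
                h \<in> Hom D X Y \<and> \<zeta> \<cdot>\<^bsub>D\<^esub> h = Farr F h \<cdot>\<^bsub>D\<^esub> \<xi>},
       Dom = (\<lambda>(A, B, h). A),
       Cod = (\<lambda>(A, B, h). B),
       Id = (\<lambda>(X, \<xi>). ((X, \<xi>), (X, \<xi>), Id D X)),
       Comp = (\<lambda>(A', B', h') (A, B, h). (A, B', h' \<cdot>\<^bsub>D\<^esub> h))\<rparr>)"

definition coprod_lift ::
  "('o, 'm) cat \<Rightarrow> (nat \<Rightarrow> (nat \<Rightarrow> 'o) \<Rightarrow> 'o) \<Rightarrow> (nat \<Rightarrow> (nat \<Rightarrow> 'o) \<Rightarrow> nat \<Rightarrow> 'm) \<Rightarrow> nat
     \<Rightarrow> ((nat \<Rightarrow> 'o) \<times> (nat \<Rightarrow> 'm),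
         ((nat \<Rightarrow> 'o) \<times> (nat \<Rightarrow> 'm)) \<times> ((nat \<Rightarrow> 'o) \<times> (nat \<Rightarrow> 'm)) \<times> (nat \<Rightarrow> 'm),
         'o \<times> 'm, ('o \<times> 'm) \<times> ('o \<times> 'm) \<times> 'm) func" where
  "coprod_lift C P \<iota> n =
     (let S = coprod_func C P \<iota> n; ob = (\<lambda>(X, \<xi>). (Fobj S X, Farr S \<xi>)) in
      \<lparr>Fobj = ob, Farr = (\<lambda>(A, B, h). (ob A, ob B, Farr S h))\<rparr>)"

end

theory Submission
  imports Defs
begin

text \<open>In an extensive category the naturality squares of the coproduct injections are pullbacks, and
  every arrow \<open>X \<rightarrow> \<Coprod>Z\<close> is, up to an isomorphism \<open>\<Coprod>Y \<cong> X\<close>, a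
  coproduct \<open>\<Coprod>f\<close> of arrows \<open>f : Y \<rightarrow> Z\<close>. If \<open>h : \<Coprod>X \<rightarrow> \<Coprod>Y\<close> is a
  coalgebra morphism between lifted coalgebras, the coalgebra square puts each restriction of \<open>h\<close>
  to \<open>X\<^sub>i\<close> over the \<open>i\<close>-th injection, so it factors uniquely through \<open>Y\<^sub>i\<close>; hence the
  lifting is fully faithful. A coalgebra \<open>x : X \<rightarrow> \<Coprod>H\<Delta>X\<close> decomposes as
  \<open>x \<cdot> p = \<Coprod>y'\<close> with \<open>p : \<Coprod>Y \<cong> X\<close>, and \<open>H\<Delta>p\<^sup>-\<^sup>1 \<cdot> y'\<close> is a coalgebra
  on \<open>Y\<close> whose lifting is isomorphic to \<open>x\<close> via \<open>p\<close>.\<close>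

section \<open>Categories and equivalences\<close>

text \<open>Extensivity is given only for two summands and as an equivalence of slices, whereas the
  argument needs n summands and elementary pullback properties. Three devices bridge the gap.
  Padding: an arrow from \<open>T\<close> to \<open>Y \<oplus> Y'\<close> is extended by an arrow
  out of the initial object to one on \<open>T \<oplus> zero\<close>, which turns a pullback problem
  into fullness of the slice functor. Doubling: the i-th summand of \<open>P n X\<close> is compared
  with the left summand of \<open>X i \<oplus> P n X\<close>, whose right summand is all of
  \<open>P n X\<close> rather than the complement of \<open>X i\<close>; this comparison is a
  natural split monomorphism, which is enough to carry the binary facts over. Induction: splitting
  off the last summand decomposes arrows into an n-fold coproduct, and its base case n = 0 is
  strictness of the initial object, which has to be extracted from the binary case. The coalgebra
  square is usable because H\<Delta>h is an arrow of the power category even when h is merely an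
  arrow between coproducts.\<close>

locale ambient_category =
  fixes C :: "('o, 'm) cat" (structure)
  assumes category: "category C"
begin

lemma comp_Hom: "f \<in> Hom C X Y \<Longrightarrow> g \<in> Hom C Y Z \<Longrightarrow> g \<cdot> f \<in> Hom C X Z"
  using category unfolding category_def Hom_def by auto

lemma comp_assoc:
  "f \<in> Hom C W X \<Longrightarrow> g \<in> Hom C X Y \<Longrightarrow> h \<in> Hom C Y Z \<Longrightarrow> h \<cdot> g \<cdot> f = h \<cdot> (g \<cdot> f)"
  using category unfolding category_def Hom_def by auto

lemma Id_Hom: "X \<in> Obj C \<Longrightarrow> Id C X \<in> Hom C X X"
  using category unfolding category_def by auto

lemma comp_Id_right: "f \<in> Hom C X Y \<Longrightarrow> f \<cdot> Id C X = f"
  and comp_Id_left: "f \<in> Hom C X Y \<Longrightarrow> Id C Y \<cdot> f = f"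
  using category unfolding category_def Hom_def by auto

lemma Hom_Obj: "f \<in> Hom C X Y \<Longrightarrow> X \<in> Obj C" "f \<in> Hom C X Y \<Longrightarrow> Y \<in> Obj C"
  using category unfolding category_def Hom_def by auto

lemma isoI:
  "f \<in> Hom C X Y \<Longrightarrow> g \<in> Hom C Y X \<Longrightarrow> g \<cdot> f = Id C X \<Longrightarrow> f \<cdot> g = Id C Y \<Longrightarrow> iso C f"
  unfolding iso_def Hom_def by auto

lemma isoE:
  assumes "iso C f" "f \<in> Hom C X Y"
  obtains g where "g \<in> Hom C Y X" "g \<cdot> f = Id C X" "f \<cdot> g = Id C Y"
  using assms unfolding iso_def Hom_def by auto

text \<open>Applying the left inverse \<open>g\<close> recovers both arrows. Only a one-sided
  inverse is assumed, so this serves for isomorphisms and also for the split monomorphism into a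
  doubled coproduct.\<close>

lemma section_cancel:
  assumes f: "f \<in> Hom C X Y" and g: "g \<in> Hom C Y X" and gf: "g \<cdot> f = Id C X"
    and u: "u \<in> Hom C T X" and v: "v \<in> Hom C T X" and eq: "f \<cdot> u = f \<cdot> v"
  shows "u = v"
proof -
  have "w = g \<cdot> (f \<cdot> w)" if "w \<in> Hom C T X" for w
    using comp_assoc[OF that f g] comp_Id_left[OF that] gf by simp
  then show ?thesis using u v eq by metis
qed

text \<open>Dual cancellation: \<open>g\<close> is the arrow cancelled on the right, and
  \<open>f\<close> is its right inverse.\<close>

lemma retraction_cancel:
  assumes f: "f \<in> Hom C X Y" and g: "g \<in> Hom C Y X" and gf: "g \<cdot> f = Id C X"
    and u: "u \<in> Hom C X T" and v: "v \<in> Hom C X T" and eq: "u \<cdot> g = v \<cdot> g"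
  shows "u = v"
proof -
  have "w = w \<cdot> g \<cdot> f" if "w \<in> Hom C X T" for w
    using comp_assoc[OF f g that] comp_Id_right[OF that] gf by simp
  then show ?thesis using u v eq by metis
qed

end

section \<open>Functors and natural isomorphisms in terms of typed arrows\<close>

lemma functor_Obj: "is_functor C D F \<Longrightarrow> X \<in> Obj C \<Longrightarrow> Fobj F X \<in> Obj D"
  unfolding is_functor_def by auto

lemma functor_Hom: "is_functor C D F \<Longrightarrow> f \<in> Hom C X Y \<Longrightarrow> Farr F f \<in> Hom D (Fobj F X) (Fobj F Y)"
  unfolding is_functor_def Hom_def by auto

lemma functor_Id: "is_functor C D F \<Longrightarrow> X \<in> Obj C \<Longrightarrow> Farr F (Id C X) = Id D (Fobj F X)"
  unfolding is_functor_def by auto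

lemma functor_comp:
  "is_functor C D F \<Longrightarrow> f \<in> Hom C X Y \<Longrightarrow> g \<in> Hom C Y Z \<Longrightarrow>
    Farr F (g \<cdot>\<^bsub>C\<^esub> f) = Farr F g \<cdot>\<^bsub>D\<^esub> Farr F f"
  unfolding is_functor_def Hom_def by auto

lemma is_functorI:
  assumes "\<And>X. X \<in> Obj C \<Longrightarrow> Fobj F X \<in> Obj D"
    and "\<And>f X Y. f \<in> Hom C X Y \<Longrightarrow> Farr F f \<in> Hom D (Fobj F X) (Fobj F Y)"
    and "\<And>X. X \<in> Obj C \<Longrightarrow> Farr F (Id C X) = Id D (Fobj F X)"
    and "\<And>f g X Y Z. f \<in> Hom C X Y \<Longrightarrow> g \<in> Hom C Y Z \<Longrightarrow>
      Farr F (g \<cdot>\<^bsub>C\<^esub> f) = Farr F g \<cdot>\<^bsub>D\<^esub> Farr F f"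
  shows "is_functor C D F"
  using assms unfolding is_functor_def Hom_def by auto

lemma is_functor_comp:
  assumes F: "is_functor C D F" and G: "is_functor D E G"
  shows "is_functor C E (G \<circ>\<^sub>F F)"
proof (rule is_functorI)
  fix f X Y assume f: "f \<in> Hom C X Y"
  show "Farr (G \<circ>\<^sub>F F) f \<in> Hom E (Fobj (G \<circ>\<^sub>F F) X) (Fobj (G \<circ>\<^sub>F F) Y)"
    using functor_Hom[OF G functor_Hom[OF F f]] by (simp add: comp_func_def)
next
  fix f g X Y Z assume f: "f \<in> Hom C X Y" and g: "g \<in> Hom C Y Z"
  show "Farr (G \<circ>\<^sub>F F) (g \<cdot>\<^bsub>C\<^esub> f) = Farr (G \<circ>\<^sub>F F) g \<cdot>\<^bsub>E\<^esub> Farr (G \<circ>\<^sub>F F) f"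
    using functor_comp[OF F f g] functor_comp[OF G functor_Hom[OF F f] functor_Hom[OF F g]]
    by (simp add: comp_func_def)
qed (simp_all add: comp_func_def functor_Obj[OF F] functor_Obj[OF G] functor_Id[OF F] functor_Id[OF G])

lemma nat_isoD:
  assumes "nat_iso C D F G \<eta>"
  shows "X \<in> Obj C \<Longrightarrow> \<eta> X \<in> Hom D (Fobj F X) (Fobj G X)"
    and "X \<in> Obj C \<Longrightarrow> iso D (\<eta> X)"
    and "f \<in> Hom C X Y \<Longrightarrow> \<eta> Y \<cdot>\<^bsub>D\<^esub> Farr F f = Farr G f \<cdot>\<^bsub>D\<^esub> \<eta> X"
  using assms unfolding nat_iso_def Hom_def by auto

section \<open>Equivalences as fully faithful and essentially surjective functors\<close>

definition fully_faithful ::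
  "('o1, 'm1) cat \<Rightarrow> ('o2, 'm2) cat \<Rightarrow> ('o1, 'm1, 'o2, 'm2) func \<Rightarrow> bool" where
  "fully_faithful C D F \<longleftrightarrow> (\<forall>X\<in>Obj C. \<forall>Y\<in>Obj C.
     bij_betw (Farr F) (Hom C X Y) (Hom D (Fobj F X) (Fobj F Y)))"

definition essentially_surjective ::
  "('o1, 'm1) cat \<Rightarrow> ('o2, 'm2) cat \<Rightarrow> ('o1, 'm1, 'o2, 'm2) func \<Rightarrow> bool" where
  "essentially_surjective C D F \<longleftrightarrow>
     (\<forall>Y\<in>Obj D. \<exists>X\<in>Obj C. \<exists>e\<in>Hom D (Fobj F X) Y. iso D e)"

lemma fully_faithfulI:
  assumes "is_functor C D F"
    and "\<And>X Y f g. f \<in> Hom C X Y \<Longrightarrow> g \<in> Hom C X Y \<Longrightarrow> Farr F f = Farr F g \<Longrightarrow> f = g"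
    and "\<And>X Y k. X \<in> Obj C \<Longrightarrow> Y \<in> Obj C \<Longrightarrow> k \<in> Hom D (Fobj F X) (Fobj F Y) \<Longrightarrow>
      \<exists>h\<in>Hom C X Y. Farr F h = k"
  shows "fully_faithful C D F"
  unfolding fully_faithful_def
proof (intro ballI bij_betw_imageI inj_onI)
  fix X Y assume X: "X \<in> Obj C" and Y: "Y \<in> Obj C"
  show "Farr F ` Hom C X Y = Hom D (Fobj F X) (Fobj F Y)"
    using assms(3)[OF X Y] functor_Hom[OF assms(1)] by blast
qed (use assms(2) in blast)

lemma fully_faithful_inj:
  assumes "fully_faithful C D F" "category C" "f \<in> Hom C X Y" "g \<in> Hom C X Y" "Farr F f = Farr F g"
  shows "f = g"
proof -
  interpret ambient_category C by unfold_locales fact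
  show ?thesis
    using assms Hom_Obj[OF assms(3)] unfolding fully_faithful_def bij_betw_def inj_on_def by blast
qed

lemma fully_faithful_surj:
  assumes "fully_faithful C D F" "X \<in> Obj C" "Y \<in> Obj C" "k \<in> Hom D (Fobj F X) (Fobj F Y)"
  obtains h where "h \<in> Hom C X Y" "Farr F h = k"
  using assms unfolding fully_faithful_def bij_betw_def by (metis imageE)

text \<open>By naturality, \<open>\<eta> Y \<cdot> f\<close> depends only on
  \<open>Farr F f\<close>, and the isomorphism \<open>\<eta> Y\<close> can be cancelled on the
  left.\<close>

lemma faithful_of_nat_iso:
  assumes C: "category C" and eta: "nat_iso C C id_func (G \<circ>\<^sub>F F) \<eta>"
    and f: "f \<in> Hom C X Y" and g: "g \<in> Hom C X Y" and eq: "Farr F f = Farr F g"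
  shows "f = g"
proof -
  interpret C: ambient_category C by unfold_locales fact
  have Y: "Y \<in> Obj C" using C.Hom_Obj[OF f] by simp
  have e: "\<eta> Y \<in> Hom C Y (Fobj (G \<circ>\<^sub>F F) Y)" using nat_isoD(1)[OF eta Y] by (simp add: id_func_def)
  obtain e' where e': "e' \<in> Hom C (Fobj (G \<circ>\<^sub>F F) Y) Y" "e' \<cdot>\<^bsub>C\<^esub> \<eta> Y = Id C Y"
    using C.isoE[OF nat_isoD(2)[OF eta Y] e] by blast
  have "\<eta> Y \<cdot>\<^bsub>C\<^esub> f = \<eta> Y \<cdot>\<^bsub>C\<^esub> g"
    using nat_isoD(3)[OF eta f] nat_isoD(3)[OF eta g] eq by (simp add: id_func_def comp_func_def)
  then show ?thesis using C.section_cancel[OF e e' f g] by simp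
qed

text \<open>The counit does for the quasi-inverse what the unit does for \<open>F\<close>.
  Faithfulness of \<open>G\<close> is what later yields fullness of \<open>F\<close>.\<close>

lemma faithful_of_nat_iso':
  assumes D: "category D" and G: "is_functor D C G" and F: "is_functor C D F"
    and eps: "nat_iso D D (F \<circ>\<^sub>F G) id_func \<epsilon>"
    and f: "f \<in> Hom D X Y" and g: "g \<in> Hom D X Y" and eq: "Farr G f = Farr G g"
  shows "f = g"
proof -
  interpret D: ambient_category D by unfold_locales fact
  have X: "X \<in> Obj D" using D.Hom_Obj[OF f] by simp
  have e: "\<epsilon> X \<in> Hom D (Fobj (F \<circ>\<^sub>F G) X) X" using nat_isoD(1)[OF eps X] by (simp add: id_func_def)
  obtain e' where e': "e' \<in> Hom D X (Fobj (F \<circ>\<^sub>F G) X)" "\<epsilon> X \<cdot>\<^bsub>D\<^esub> e' = Id D X"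
    using D.isoE[OF nat_isoD(2)[OF eps X] e] by blast
  have "f \<cdot>\<^bsub>D\<^esub> \<epsilon> X = g \<cdot>\<^bsub>D\<^esub> \<epsilon> X"
    using nat_isoD(3)[OF eps f] nat_isoD(3)[OF eps g] eq by (simp add: id_func_def comp_func_def)
  then show ?thesis using D.retraction_cancel[OF e'(1) e e'(2) f g] by simp
qed

text \<open>Fullness is the substantial half. The candidate preimage of \<open>k\<close> is the
  conjugate of \<open>G k\<close> by the unit; naturality makes \<open>G\<close> agree on
  \<open>F h\<close> and \<open>k\<close>, and faithfulness of \<open>G\<close> then identifies
  them.\<close>

lemma equivalence_fully_faithful:
  assumes C: "category C" and D: "category D" and "is_equivalence C D F"
  shows "fully_faithful C D F"
proof -
  interpret C: ambient_category C by unfold_locales fact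
  interpret D: ambient_category D by unfold_locales fact
  from assms obtain G \<eta> \<epsilon> where F: "is_functor C D F" and G: "is_functor D C G"
    and eta: "nat_iso C C id_func (G \<circ>\<^sub>F F) \<eta>" and eps: "nat_iso D D (F \<circ>\<^sub>F G) id_func \<epsilon>"
    unfolding is_equivalence_def by blast
  show ?thesis
  proof (rule fully_faithfulI[OF F])
    fix X Y f g assume "f \<in> Hom C X Y" "g \<in> Hom C X Y" "Farr F f = Farr F g"
    then show "f = g" by (rule faithful_of_nat_iso[OF C eta])
  next
    fix X Y k assume X: "X \<in> Obj C" and Y: "Y \<in> Obj C" and k: "k \<in> Hom D (Fobj F X) (Fobj F Y)"
    let ?X = "Fobj G (Fobj F X)" and ?Y = "Fobj G (Fobj F Y)"
    have eX: "\<eta> X \<in> Hom C X ?X" and eY: "\<eta> Y \<in> Hom C Y ?Y"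
      using nat_isoD(1)[OF eta X] nat_isoD(1)[OF eta Y] by (simp_all add: id_func_def comp_func_def)
    obtain iX where iX: "iX \<in> Hom C ?X X" "\<eta> X \<cdot>\<^bsub>C\<^esub> iX = Id C ?X"
      using C.isoE[OF nat_isoD(2)[OF eta X] eX] by blast
    obtain iY where iY: "iY \<in> Hom C ?Y Y" "\<eta> Y \<cdot>\<^bsub>C\<^esub> iY = Id C ?Y"
      using C.isoE[OF nat_isoD(2)[OF eta Y] eY] by blast
    have Gk: "Farr G k \<in> Hom C ?X ?Y" by (rule functor_Hom[OF G k])
    have Gke: "Farr G k \<cdot>\<^bsub>C\<^esub> \<eta> X \<in> Hom C X ?Y" by (rule C.comp_Hom[OF eX Gk])
    define h where "h = iY \<cdot>\<^bsub>C\<^esub> (Farr G k \<cdot>\<^bsub>C\<^esub> \<eta> X)"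
    have h: "h \<in> Hom C X Y" unfolding h_def by (rule C.comp_Hom[OF Gke iY(1)])
    have "\<eta> Y \<cdot>\<^bsub>C\<^esub> h = Farr G k \<cdot>\<^bsub>C\<^esub> \<eta> X"
      unfolding h_def C.comp_assoc[OF Gke iY(1) eY, symmetric] iY(2) by (rule C.comp_Id_left[OF Gke])
    then have "Farr G (Farr F h) \<cdot>\<^bsub>C\<^esub> \<eta> X = Farr G k \<cdot>\<^bsub>C\<^esub> \<eta> X"
      using nat_isoD(3)[OF eta h] by (simp add: id_func_def comp_func_def)
    then have "Farr G (Farr F h) = Farr G k"
      using C.retraction_cancel[OF iX(1) eX iX(2) functor_Hom[OF G functor_Hom[OF F h]] Gk] by simp
    then have "Farr F h = k"
      using faithful_of_nat_iso'[OF D G F eps functor_Hom[OF F h] k] by simp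
    with h show "\<exists>h\<in>Hom C X Y. Farr F h = k" by blast
  qed
qed

lemma equivalence_essentially_surjective:
  assumes "is_equivalence C D F"
  shows "essentially_surjective C D F"
proof -
  from assms obtain G \<epsilon> where G: "is_functor D C G" and eps: "nat_iso D D (F \<circ>\<^sub>F G) id_func \<epsilon>"
    unfolding is_equivalence_def by blast
  show ?thesis unfolding essentially_surjective_def
    using nat_isoD(1,2)[OF eps] functor_Obj[OF G]
    by (metis comp_func_def func.select_convs(1) id_func_def)
qed

text \<open>The quasi-inverse is built by choice: \<open>g Y\<close> comes with an isomorphism
  \<open>e Y\<close> from \<open>F (g Y)\<close> to \<open>Y\<close>, and an arrow \<open>k\<close>
  goes to the \<open>F\<close>-preimage of its conjugate by \<open>e\<close>. The family
  \<open>e\<close> becomes the counit.\<close>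

lemma equivalenceI:
  assumes C: "category C" and D: "category D" and F: "is_functor C D F"
    and ff: "fully_faithful C D F" and es: "essentially_surjective C D F"
  shows "is_equivalence C D F"
proof -
  interpret C: ambient_category C by unfold_locales fact
  interpret D: ambient_category D by unfold_locales fact
  have "\<forall>Y\<in>Obj D. \<exists>X e e'. X \<in> Obj C \<and> e \<in> Hom D (Fobj F X) Y \<and> e' \<in> Hom D Y (Fobj F X) \<and>
      e' \<cdot>\<^bsub>D\<^esub> e = Id D (Fobj F X) \<and> e \<cdot>\<^bsub>D\<^esub> e' = Id D Y"
    using es unfolding essentially_surjective_def by (meson D.isoE)
  then obtain g e e' where g: "\<And>Y. Y \<in> Obj D \<Longrightarrow> g Y \<in> Obj C"
    and e: "\<And>Y. Y \<in> Obj D \<Longrightarrow> e Y \<in> Hom D (Fobj F (g Y)) Y"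
    and e': "\<And>Y. Y \<in> Obj D \<Longrightarrow> e' Y \<in> Hom D Y (Fobj F (g Y))"
    and e'e: "\<And>Y. Y \<in> Obj D \<Longrightarrow> e' Y \<cdot>\<^bsub>D\<^esub> e Y = Id D (Fobj F (g Y))"
    and ee': "\<And>Y. Y \<in> Obj D \<Longrightarrow> e Y \<cdot>\<^bsub>D\<^esub> e' Y = Id D Y"
    by metis
  define L where "L X Y k = (SOME h. h \<in> Hom C X Y \<and> Farr F h = k)" for X Y k
  have L: "L X Y k \<in> Hom C X Y" "Farr F (L X Y k) = k"
    if "X \<in> Obj C" "Y \<in> Obj C" "k \<in> Hom D (Fobj F X) (Fobj F Y)" for X Y k
  proof -
    have "\<exists>h. h \<in> Hom C X Y \<and> Farr F h = k" using fully_faithful_surj[OF ff that] by metis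
    from someI_ex[OF this] show "L X Y k \<in> Hom C X Y" "Farr F (L X Y k) = k" unfolding L_def by auto
  qed
  define G where "G = \<lparr>Fobj = g,
    Farr = (\<lambda>k. L (g (Dom D k)) (g (Cod D k)) (e' (Cod D k) \<cdot>\<^bsub>D\<^esub> (k \<cdot>\<^bsub>D\<^esub> e (Dom D k))))\<rparr>"
  have conj_Hom: "e' Y \<cdot>\<^bsub>D\<^esub> (k \<cdot>\<^bsub>D\<^esub> e X) \<in> Hom D (Fobj F (g X)) (Fobj F (g Y))"
    if "k \<in> Hom D X Y" for k X Y
    using D.comp_Hom[OF D.comp_Hom[OF e that] e'] D.Hom_Obj[OF that] by blast
  have G_Farr: "Farr G k \<in> Hom C (g X) (g Y)" "Farr F (Farr G k) = e' Y \<cdot>\<^bsub>D\<^esub> (k \<cdot>\<^bsub>D\<^esub> e X)"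
    if k: "k \<in> Hom D X Y" for k X Y
    using L[OF g g conj_Hom[OF k]] D.Hom_Obj[OF k] k unfolding G_def Hom_def by auto
  have G_nat: "e Y \<cdot>\<^bsub>D\<^esub> Farr F (Farr G k) = k \<cdot>\<^bsub>D\<^esub> e X" if k: "k \<in> Hom D X Y" for k X Y
  proof -
    have X: "X \<in> Obj D" and Y: "Y \<in> Obj D" using D.Hom_Obj[OF k] by auto
    have ke: "k \<cdot>\<^bsub>D\<^esub> e X \<in> Hom D (Fobj F (g X)) Y" by (rule D.comp_Hom[OF e[OF X] k])
    show ?thesis
      unfolding G_Farr(2)[OF k] D.comp_assoc[OF ke e'[OF Y] e[OF Y], symmetric] ee'[OF Y]
      by (rule D.comp_Id_left[OF ke])
  qed
  \<comment> \<open>Naturality of \<open>e\<close> at \<open>k\<close> characterises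
    \<open>Farr G k\<close>, since \<open>e Y\<close> is monic and \<open>F\<close> is faithful.
    Each functor law then amounts to checking this one equation.\<close>
  have G_unique: "Farr G k = h"
    if k: "k \<in> Hom D X Y" and h: "h \<in> Hom C (g X) (g Y)"
      and eq: "e Y \<cdot>\<^bsub>D\<^esub> Farr F h = k \<cdot>\<^bsub>D\<^esub> e X" for k h X Y
  proof (rule fully_faithful_inj[OF ff C G_Farr(1)[OF k] h])
    have Y: "Y \<in> Obj D" using D.Hom_Obj[OF k] by auto
    show "Farr F (Farr G k) = Farr F h"
      by (rule D.section_cancel[OF e[OF Y] e'[OF Y] e'e[OF Y]
            functor_Hom[OF F G_Farr(1)[OF k]] functor_Hom[OF F h]])
         (simp add: G_nat[OF k] eq)
  qed
  have G: "is_functor D C G"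
  proof (rule is_functorI)
    fix X assume X: "X \<in> Obj D"
    then show "Fobj G X \<in> Obj C" by (simp add: G_def g)
    have "Farr G (Id D X) = Id C (g X)"
      by (rule G_unique[OF D.Id_Hom[OF X] C.Id_Hom[OF g[OF X]]])
         (simp add: functor_Id[OF F g[OF X]] D.comp_Id_left[OF e[OF X]] D.comp_Id_right[OF e[OF X]])
    then show "Farr G (Id D X) = Id C (Fobj G X)" by (simp add: G_def)
  next
    fix f X Y assume "f \<in> Hom D X Y"
    then show "Farr G f \<in> Hom C (Fobj G X) (Fobj G Y)" using G_Farr(1) by (simp add: G_def)
  next
    fix f k X Y Z assume f: "f \<in> Hom D X Y" and k: "k \<in> Hom D Y Z"
    have X: "X \<in> Obj D" and Y: "Y \<in> Obj D" and Z: "Z \<in> Obj D"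
      using D.Hom_Obj[OF f] D.Hom_Obj[OF k] by auto
    note Gf = G_Farr(1)[OF f] and Gk = G_Farr(1)[OF k]
    note FGf = functor_Hom[OF F Gf] and FGk = functor_Hom[OF F Gk]
    show "Farr G (k \<cdot>\<^bsub>D\<^esub> f) = Farr G k \<cdot>\<^bsub>C\<^esub> Farr G f"
    proof (rule G_unique[OF D.comp_Hom[OF f k] C.comp_Hom[OF Gf Gk]])
      have "e Z \<cdot>\<^bsub>D\<^esub> Farr F (Farr G k \<cdot>\<^bsub>C\<^esub> Farr G f) = e Z \<cdot>\<^bsub>D\<^esub> Farr F (Farr G k) \<cdot>\<^bsub>D\<^esub> Farr F (Farr G f)"
        unfolding functor_comp[OF F Gf Gk] by (rule D.comp_assoc[OF FGf FGk e[OF Z], symmetric])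
      also have "\<dots> = k \<cdot>\<^bsub>D\<^esub> (e Y \<cdot>\<^bsub>D\<^esub> Farr F (Farr G f))"
        unfolding G_nat[OF k] by (rule D.comp_assoc[OF FGf e[OF Y] k])
      also have "\<dots> = k \<cdot>\<^bsub>D\<^esub> f \<cdot>\<^bsub>D\<^esub> e X"
        unfolding G_nat[OF f] by (rule D.comp_assoc[OF e[OF X] f k, symmetric])
      finally show "e Z \<cdot>\<^bsub>D\<^esub> Farr F (Farr G k \<cdot>\<^bsub>C\<^esub> Farr G f) = k \<cdot>\<^bsub>D\<^esub> f \<cdot>\<^bsub>D\<^esub> e X" .
    qed
  qed
  \<comment> \<open>The unit is forced by a triangle identity: \<open>F\<close> must send
    \<open>\<eta> X\<close> to the inverse of \<open>e\<close> at \<open>F X\<close>. Fullness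
    supplies such an arrow, and lifting \<open>e\<close> itself supplies its inverse.\<close>
  define \<eta> where "\<eta> X = L X (g (Fobj F X)) (e' (Fobj F X))" for X
  have eta: "\<eta> X \<in> Hom C X (g (Fobj F X))" "Farr F (\<eta> X) = e' (Fobj F X)" if X: "X \<in> Obj C" for X
    unfolding \<eta>_def using L[OF X g e'] functor_Obj[OF F X] by blast+
  have "iso C (\<eta> X)" if X: "X \<in> Obj C" for X
  proof -
    have FX: "Fobj F X \<in> Obj D" by (rule functor_Obj[OF F X])
    note g = g[OF FX]
    obtain h where h: "h \<in> Hom C (g (Fobj F X)) X" "Farr F h = e (Fobj F X)"
      using fully_faithful_surj[OF ff g X e[OF FX]] by blast
    show ?thesis
    proof (rule C.isoI[OF eta(1)[OF X] h(1)])
      show "h \<cdot>\<^bsub>C\<^esub> \<eta> X = Id C X"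
        by (rule fully_faithful_inj[OF ff C C.comp_Hom[OF eta(1)[OF X] h(1)] C.Id_Hom[OF X]])
           (simp add: functor_comp[OF F eta(1)[OF X] h(1)] eta(2)[OF X] h(2) functor_Id[OF F X] ee'[OF FX])
      show "\<eta> X \<cdot>\<^bsub>C\<^esub> h = Id C (g (Fobj F X))"
        by (rule fully_faithful_inj[OF ff C C.comp_Hom[OF h(1) eta(1)[OF X]] C.Id_Hom[OF g]])
           (simp add: functor_comp[OF F h(1) eta(1)[OF X]] eta(2)[OF X] h(2) functor_Id[OF F g] e'e[OF FX])
    qed
  qed
  moreover have "\<eta> Y \<cdot>\<^bsub>C\<^esub> f = Farr G (Farr F f) \<cdot>\<^bsub>C\<^esub> \<eta> X" if f: "f \<in> Hom C X Y" for f X Y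
  proof -
    have X: "X \<in> Obj C" and Y: "Y \<in> Obj C" using C.Hom_Obj[OF f] by auto
    note FX = functor_Obj[OF F X] and FY = functor_Obj[OF F Y] and Ff = functor_Hom[OF F f]
    note GFf = G_Farr(1)[OF Ff]
    show ?thesis
    proof (rule fully_faithful_inj[OF ff C C.comp_Hom[OF f eta(1)[OF Y]] C.comp_Hom[OF eta(1)[OF X] GFf]])
      have ke: "Farr F f \<cdot>\<^bsub>D\<^esub> e (Fobj F X) \<in> Hom D (Fobj F (g (Fobj F X))) (Fobj F Y)"
        by (rule D.comp_Hom[OF e[OF FX] Ff])
      show "Farr F (\<eta> Y \<cdot>\<^bsub>C\<^esub> f) = Farr F (Farr G (Farr F f) \<cdot>\<^bsub>C\<^esub> \<eta> X)"
        unfolding functor_comp[OF F f eta(1)[OF Y]] functor_comp[OF F eta(1)[OF X] GFf]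
          eta(2)[OF X] eta(2)[OF Y] G_Farr(2)[OF Ff] D.comp_assoc[OF e'[OF FX] ke e'[OF FY]]
          D.comp_assoc[OF e'[OF FX] e[OF FX] Ff] ee'[OF FX] D.comp_Id_right[OF Ff] ..
    qed
  qed
  ultimately have "nat_iso C C id_func (G \<circ>\<^sub>F F) \<eta>"
    unfolding nat_iso_def using eta(1) by (auto simp: id_func_def comp_func_def G_def Hom_def)
  moreover have "nat_iso D D (F \<circ>\<^sub>F G) id_func e"
    unfolding nat_iso_def
  proof (intro conjI ballI)
    fix X assume X: "X \<in> Obj D"
    show "e X \<in> Hom D (Fobj (F \<circ>\<^sub>F G) X) (Fobj id_func X)"
      using e[OF X] by (simp add: comp_func_def id_func_def G_def)
    show "iso D (e X)" by (rule D.isoI[OF e e' e'e ee']; fact X)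
  next
    fix f assume "f \<in> Arr D"
    then have "f \<in> Hom D (Dom D f) (Cod D f)" by (simp add: Hom_def)
    from G_nat[OF this] show "e (Cod D f) \<cdot>\<^bsub>D\<^esub> Farr (F \<circ>\<^sub>F G) f = Farr id_func f \<cdot>\<^bsub>D\<^esub> e (Dom D f)"
      by (simp add: comp_func_def id_func_def)
  qed
  ultimately show ?thesis unfolding is_equivalence_def using F G by blast
qed

section \<open>Constructions of categories\<close>

lemma categoryI:
  assumes "\<And>f. f \<in> Arr C \<Longrightarrow> Dom C f \<in> Obj C" "\<And>f. f \<in> Arr C \<Longrightarrow> Cod C f \<in> Obj C"
    and "\<And>X. X \<in> Obj C \<Longrightarrow> Id C X \<in> Hom C X X"
    and "\<And>f g X Y Z. f \<in> Hom C X Y \<Longrightarrow> g \<in> Hom C Y Z \<Longrightarrow> g \<cdot>\<^bsub>C\<^esub> f \<in> Hom C X Z"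
    and "\<And>f X Y. f \<in> Hom C X Y \<Longrightarrow> f \<cdot>\<^bsub>C\<^esub> Id C X = f"
    and "\<And>f X Y. f \<in> Hom C X Y \<Longrightarrow> Id C Y \<cdot>\<^bsub>C\<^esub> f = f"
    and "\<And>f g h W X Y Z. f \<in> Hom C W X \<Longrightarrow> g \<in> Hom C X Y \<Longrightarrow> h \<in> Hom C Y Z \<Longrightarrow>
      h \<cdot>\<^bsub>C\<^esub> g \<cdot>\<^bsub>C\<^esub> f = h \<cdot>\<^bsub>C\<^esub> (g \<cdot>\<^bsub>C\<^esub> f)"
  shows "category C"
  unfolding category_def using assms unfolding Hom_def by auto

lemma category_prod:
  assumes "category C" "category D"
  shows "category (prod_cat C D)"
  using assms unfolding category_def by (auto simp: prod_cat_def Hom_def)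

context ambient_category
begin

lemma Arr_Hom: "f \<in> Arr C \<longleftrightarrow> f \<in> Hom C (Dom C f) (Cod C f)"
  by (simp add: Hom_def)

lemma HomD: "f \<in> Hom C X Y \<Longrightarrow> f \<in> Arr C" "f \<in> Hom C X Y \<Longrightarrow> Dom C f = X"
  "f \<in> Hom C X Y \<Longrightarrow> Cod C f = Y"
  by (simp_all add: Hom_def)

section \<open>Slices and coalgebras in terms of typed arrows\<close>

lemma slice_Obj: "f \<in> Obj (slice C Y) \<longleftrightarrow> f \<in> Hom C (Dom C f) Y"
  by (auto simp: slice_def Hom_def)

lemma slice_Hom:
  "t \<in> Hom (slice C Y) f g \<longleftrightarrow> f \<in> Hom C (Dom C f) Y \<and> g \<in> Hom C (Dom C g) Y \<and>
     (\<exists>h \<in> Hom C (Dom C f) (Dom C g). t = (f, g, h) \<and> g \<cdot> h = f)"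
  by (auto simp: slice_def Hom_def)

lemma category_slice: "category (slice C Y)"
proof (rule categoryI)
  fix f g h W X V Z assume "f \<in> Hom (slice C Y) W X" "g \<in> Hom (slice C Y) X V" "h \<in> Hom (slice C Y) V Z"
  then show "h \<cdot>\<^bsub>slice C Y\<^esub> g \<cdot>\<^bsub>slice C Y\<^esub> f = h \<cdot>\<^bsub>slice C Y\<^esub> (g \<cdot>\<^bsub>slice C Y\<^esub> f)"
    unfolding slice_Hom by (auto simp: slice_def intro: comp_assoc)
next
  fix f g X V Z assume "f \<in> Hom (slice C Y) X V" "g \<in> Hom (slice C Y) V Z"
  then show "g \<cdot>\<^bsub>slice C Y\<^esub> f \<in> Hom (slice C Y) X Z"
    unfolding slice_Hom by (auto simp: slice_def comp_assoc[symmetric] intro: comp_Hom)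
next
  fix X assume "X \<in> Obj (slice C Y)"
  then show "Id (slice C Y) X \<in> Hom (slice C Y) X X"
    unfolding slice_Hom slice_Obj by (auto simp: slice_def comp_Id_right dest: Hom_Obj intro: Id_Hom)
next
  fix f X V assume "f \<in> Hom (slice C Y) X V"
  then show "f \<cdot>\<^bsub>slice C Y\<^esub> Id (slice C Y) X = f" "Id (slice C Y) V \<cdot>\<^bsub>slice C Y\<^esub> f = f"
    unfolding slice_Hom by (auto simp: slice_def comp_Id_right comp_Id_left)
qed (auto simp: slice_def)

lemma coalg_Obj: "(X, x) \<in> Obj (coalg C F) \<longleftrightarrow> X \<in> Obj C \<and> x \<in> Hom C X (Fobj F X)"
  by (simp add: coalg_def Let_def)

lemma coalg_Hom:
  "t \<in> Hom (coalg C F) (X, x) (Y, y) \<longleftrightarrow>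
     x \<in> Hom C X (Fobj F X) \<and> y \<in> Hom C Y (Fobj F Y) \<and>
     (\<exists>h \<in> Hom C X Y. t = ((X, x), (Y, y), h) \<and> y \<cdot> h = Farr F h \<cdot> x)"
  by (auto simp: coalg_def Let_def Hom_def[of "_ :: (_, _) cat" "(_, _)"] dest: Hom_Obj)

lemma category_coalg:
  assumes F: "is_functor C C F"
  shows "category (coalg C F)"
proof (rule categoryI)
  fix f g h W X V Z
  assume "f \<in> Hom (coalg C F) W X" "g \<in> Hom (coalg C F) X V" "h \<in> Hom (coalg C F) V Z"
  then show "h \<cdot>\<^bsub>coalg C F\<^esub> g \<cdot>\<^bsub>coalg C F\<^esub> f = h \<cdot>\<^bsub>coalg C F\<^esub> (g \<cdot>\<^bsub>coalg C F\<^esub> f)"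
    by (cases W; cases X; cases V; cases Z) (auto simp: coalg_Hom, auto simp: coalg_def Let_def intro: comp_assoc)
next
  fix f g X V Z assume fg: "f \<in> Hom (coalg C F) X V" "g \<in> Hom (coalg C F) V Z"
  obtain X' x V' v Z' z where XVZ: "X = (X', x)" "V = (V', v)" "Z = (Z', z)"
    by (cases X; cases V; cases Z)
  from fg obtain h k where x: "x \<in> Hom C X' (Fobj F X')" and v: "v \<in> Hom C V' (Fobj F V')"
    and z: "z \<in> Hom C Z' (Fobj F Z')"
    and h: "h \<in> Hom C X' V'" and k: "k \<in> Hom C V' Z'" and f: "f = (X, V, h)" and g: "g = (V, Z, k)"
    and eq: "v \<cdot> h = Farr F h \<cdot> x" "z \<cdot> k = Farr F k \<cdot> v"
    unfolding XVZ coalg_Hom by auto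
  note Fh = functor_Hom[OF F h] and Fk = functor_Hom[OF F k]
  \<comment> \<open>Pasting of the two coalgebra squares along the structure map
    \<open>v\<close>.\<close>
  have "z \<cdot> (k \<cdot> h) = Farr F k \<cdot> (v \<cdot> h)"
    unfolding comp_assoc[OF h k z, symmetric] eq(2) by (rule comp_assoc[OF h v Fk])
  also have "\<dots> = Farr F (k \<cdot> h) \<cdot> x"
    unfolding eq(1) functor_comp[OF F h k] by (rule comp_assoc[OF x Fh Fk, symmetric])
  finally show "g \<cdot>\<^bsub>coalg C F\<^esub> f \<in> Hom (coalg C F) X Z"
    using comp_Hom[OF h k] x z unfolding f g XVZ coalg_Hom by (simp add: coalg_def Let_def)
next
  fix X assume "X \<in> Obj (coalg C F)"
  then show "Id (coalg C F) X \<in> Hom (coalg C F) X X"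
    by (cases X) (auto simp: coalg_Hom coalg_Obj, auto simp: coalg_def Let_def Id_Hom comp_Id_right
        comp_Id_left functor_Id[OF F])
next
  fix f X V assume "f \<in> Hom (coalg C F) X V"
  then show "f \<cdot>\<^bsub>coalg C F\<^esub> Id (coalg C F) X = f" "Id (coalg C F) V \<cdot>\<^bsub>coalg C F\<^esub> f = f"
    by (cases X; cases V; auto simp: coalg_Hom, auto simp: coalg_def Let_def comp_Id_right comp_Id_left)+
qed (auto simp: coalg_def Let_def)

section \<open>Powers of a category and the diagonal\<close>

lemma power_Obj: "X \<in> Obj (power_cat C n) \<longleftrightarrow> X \<in> extensional {..<n} \<and> (\<forall>i<n. X i \<in> Obj C)"
  by (auto simp: power_cat_def PiE_def Pi_def)

text \<open>The domain and codomain of a family are restricted to the index set, so only extensional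
  \<open>X\<close> and \<open>Y\<close> can occur as endpoints; hence extensionality appears three
  times.\<close>

lemma power_Hom:
  "f \<in> Hom (power_cat C n) X Y \<longleftrightarrow> X \<in> extensional {..<n} \<and> Y \<in> extensional {..<n} \<and>
     f \<in> extensional {..<n} \<and> (\<forall>i<n. f i \<in> Hom C (X i) (Y i))"
proof -
  have "restrict g A = Z \<longleftrightarrow> Z \<in> extensional A \<and> (\<forall>i\<in>A. g i = Z i)" for g A and Z :: "nat \<Rightarrow> 'o"
    by (auto intro: extensionalityI)
  then show ?thesis by (auto simp: Hom_def power_cat_def PiE_def Pi_def)
qed

lemma power_comp: "i < n \<Longrightarrow> (g \<cdot>\<^bsub>power_cat C n\<^esub> f) i = g i \<cdot> f i"
  by (simp add: power_cat_def)

lemma power_Id: "i < n \<Longrightarrow> Id (power_cat C n) X i = Id C (X i)"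
  by (simp add: power_cat_def)

lemma power_extensional:
  "g \<cdot>\<^bsub>power_cat C n\<^esub> f \<in> extensional {..<n}" "Id (power_cat C n) X \<in> extensional {..<n}"
  by (simp_all add: power_cat_def)

lemma power_eqI:
  "f \<in> extensional {..<n} \<Longrightarrow> g \<in> extensional {..<n} \<Longrightarrow> (\<And>i. i < n \<Longrightarrow> f i = g i) \<Longrightarrow> f = g"
  by (auto intro: extensionalityI)

lemma category_power: "category (power_cat C n)"
proof (rule categoryI)
  fix f g h W X Y Z
  assume "f \<in> Hom (power_cat C n) W X" "g \<in> Hom (power_cat C n) X Y" "h \<in> Hom (power_cat C n) Y Z"
  then show "h \<cdot>\<^bsub>power_cat C n\<^esub> g \<cdot>\<^bsub>power_cat C n\<^esub> f = h \<cdot>\<^bsub>power_cat C n\<^esub> (g \<cdot>\<^bsub>power_cat C n\<^esub> f)"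
    by - (rule power_eqI[OF power_extensional(1) power_extensional(1)],
        auto simp: power_Hom power_comp intro: comp_assoc)
next
  fix f X Y assume "f \<in> Hom (power_cat C n) X Y"
  then show "f \<cdot>\<^bsub>power_cat C n\<^esub> Id (power_cat C n) X = f" "Id (power_cat C n) Y \<cdot>\<^bsub>power_cat C n\<^esub> f = f"
    by - (rule power_eqI[OF power_extensional(1)],
        auto simp: power_Hom power_comp power_Id intro: comp_Id_right comp_Id_left)+
next
  fix f assume "f \<in> Arr (power_cat C n)"
  then show "Dom (power_cat C n) f \<in> Obj (power_cat C n)" "Cod (power_cat C n) f \<in> Obj (power_cat C n)"
    by (auto simp: power_cat_def PiE_iff Arr_Hom intro: Hom_Obj)
qed (auto simp: power_Hom power_Obj power_comp power_Id power_extensional intro: Id_Hom comp_Hom)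

lemma is_functor_diag: "is_functor C (power_cat C n) (diag_func n)"
proof (rule is_functorI)
  fix f g X Y Z assume "f \<in> Hom C X Y" "g \<in> Hom C Y Z"
  show "Farr (diag_func n) (g \<cdot> f) = Farr (diag_func n) g \<cdot>\<^bsub>power_cat C n\<^esub> Farr (diag_func n) f"
    by (rule power_eqI[where n = n]) (simp_all add: diag_func_def power_extensional power_comp)
next
  fix X show "Farr (diag_func n) (Id C X) = Id (power_cat C n) (Fobj (diag_func n) X)"
    by (rule power_eqI[where n = n]) (simp_all add: diag_func_def power_extensional power_Id)
qed (auto simp: power_Obj power_Hom diag_func_def)

section \<open>Coproduct cocones\<close>

lemma is_coproductI:
  assumes "S \<in> Obj C" "\<And>i. i < n \<Longrightarrow> k i \<in> Hom C (X i) S"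
    and "\<And>Y f. Y \<in> Obj C \<Longrightarrow> (\<And>i. i < n \<Longrightarrow> f i \<in> Hom C (X i) Y) \<Longrightarrow>
      \<exists>h\<in>Hom C S Y. \<forall>i<n. h \<cdot> k i = f i"
    and "\<And>Y h h'. h \<in> Hom C S Y \<Longrightarrow> h' \<in> Hom C S Y \<Longrightarrow> (\<And>i. i < n \<Longrightarrow> h \<cdot> k i = h' \<cdot> k i) \<Longrightarrow> h = h'"
  shows "is_coproduct C n X S k"
  unfolding is_coproduct_def
proof (intro conjI ballI allI impI)
  fix Y f assume Y: "Y \<in> Obj C" and f: "\<forall>i<n. f i \<in> Hom C (X i) Y"
  obtain h where h: "h \<in> Hom C S Y" "\<forall>i<n. h \<cdot> k i = f i" using assms(3)[OF Y] f by blast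
  show "\<exists>!h. h \<in> Hom C S Y \<and> (\<forall>i<n. h \<cdot> k i = f i)"
  proof (rule ex1I)
    show "h \<in> Hom C S Y \<and> (\<forall>i<n. h \<cdot> k i = f i)" using h by blast
    fix h' assume "h' \<in> Hom C S Y \<and> (\<forall>i<n. h' \<cdot> k i = f i)"
    then show "h' = h" using assms(4)[of h' Y h] h by simp
  qed
qed (use assms in auto)

lemma coproduct_inj: "is_coproduct C n X S k \<Longrightarrow> i < n \<Longrightarrow> k i \<in> Hom C (X i) S"
  unfolding is_coproduct_def by blast

lemma coproduct_copair:
  assumes "is_coproduct C n X S k" "Y \<in> Obj C" "\<And>i. i < n \<Longrightarrow> f i \<in> Hom C (X i) Y"
  obtains h where "h \<in> Hom C S Y" "\<And>i. i < n \<Longrightarrow> h \<cdot> k i = f i"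
  using assms unfolding is_coproduct_def by metis

lemma coproduct_eqI:
  assumes k: "is_coproduct C n X S k" and h: "h \<in> Hom C S Y" and h': "h' \<in> Hom C S Y"
    and eq: "\<And>i. i < n \<Longrightarrow> h \<cdot> k i = h' \<cdot> k i"
  shows "h = h'"
proof -
  have "Y \<in> Obj C" "\<forall>i<n. h \<cdot> k i \<in> Hom C (X i) Y"
    using Hom_Obj[OF h] comp_Hom[OF coproduct_inj[OF k] h] by auto
  then have "\<exists>!h''. h'' \<in> Hom C S Y \<and> (\<forall>i<n. h'' \<cdot> k i = h \<cdot> k i)"
    using k[unfolded is_coproduct_def, THEN conjunct2, THEN conjunct2, rule_format] by simp
  then obtain g where "\<And>h''. h'' \<in> Hom C S Y \<Longrightarrow> \<forall>i<n. h'' \<cdot> k i = h \<cdot> k i \<Longrightarrow> h'' = g"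
    by (elim ex1E) blast
  from this[OF h] this[OF h'] show ?thesis by (simp add: eq)
qed

text \<open>A cocone is inspected only at indices below \<open>n\<close>. This permits switching
  between the extensional families required by the power category and unrestricted ones, which are
  easier to build by case distinction.\<close>

lemma is_coproduct_cong:
  "(\<And>i. i < n \<Longrightarrow> X i = X' i) \<Longrightarrow> (\<And>i. i < n \<Longrightarrow> k i = k' i) \<Longrightarrow>
    is_coproduct C n X S k \<Longrightarrow> is_coproduct C n X' S k'"
  unfolding is_coproduct_def by simp

text \<open>A mediating arrow out of \<open>S\<close> becomes one out of \<open>T\<close> by
  precomposing with \<open>q\<close>; uniqueness holds because \<open>p\<close> can be cancelled on
  the right.\<close>

lemma is_coproduct_iso:
  assumes k: "is_coproduct C n X S k" and p: "p \<in> Hom C S T" and q: "q \<in> Hom C T S"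
    and qp: "q \<cdot> p = Id C S" and pq: "p \<cdot> q = Id C T"
  shows "is_coproduct C n X T (\<lambda>i. p \<cdot> k i)"
proof (rule is_coproductI)
  show "T \<in> Obj C" using Hom_Obj[OF p] by simp
  show "p \<cdot> k i \<in> Hom C (X i) T" if "i < n" for i by (rule comp_Hom[OF coproduct_inj[OF k that] p])
next
  fix Y f assume "Y \<in> Obj C" "\<And>i. i < n \<Longrightarrow> f i \<in> Hom C (X i) Y"
  then obtain h where h: "h \<in> Hom C S Y" "\<And>i. i < n \<Longrightarrow> h \<cdot> k i = f i"
    using coproduct_copair[OF k] by metis
  have "h \<cdot> q \<cdot> (p \<cdot> k i) = f i" if i: "i < n" for i
    using comp_assoc[OF comp_Hom[OF coproduct_inj[OF k i] p] q h(1)]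
      comp_assoc[OF coproduct_inj[OF k i] p q] comp_Id_left[OF coproduct_inj[OF k i]] qp h(2)[OF i] by simp
  then show "\<exists>h\<in>Hom C T Y. \<forall>i<n. h \<cdot> (p \<cdot> k i) = f i" using comp_Hom[OF q h(1)] by blast
next
  fix Y h h' assume h: "h \<in> Hom C T Y" "h' \<in> Hom C T Y"
    and eq: "\<And>i. i < n \<Longrightarrow> h \<cdot> (p \<cdot> k i) = h' \<cdot> (p \<cdot> k i)"
  have "h \<cdot> p = h' \<cdot> p"
    by (rule coproduct_eqI[OF k comp_Hom[OF p h(1)] comp_Hom[OF p h(2)]])
       (simp add: eq comp_assoc[OF coproduct_inj[OF k] p h(1)] comp_assoc[OF coproduct_inj[OF k] p h(2)])
  then show "h = h'" using retraction_cancel[OF q p pq h] by simp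
qed

text \<open>Each cocone mediates to the other, and both composites agree with the identity on
  injections. The compatibility with injections is recorded along with the isomorphism because later
  calculations compare arrows injection by injection.\<close>

lemma coproduct_unique_iso:
  assumes k: "is_coproduct C n X S k" and l: "is_coproduct C n X T l"
  obtains p q where "p \<in> Hom C S T" "q \<in> Hom C T S" "q \<cdot> p = Id C S" "p \<cdot> q = Id C T"
    "\<And>i. i < n \<Longrightarrow> p \<cdot> k i = l i" "\<And>i. i < n \<Longrightarrow> q \<cdot> l i = k i"
proof -
  have S: "S \<in> Obj C" and T: "T \<in> Obj C" using k l unfolding is_coproduct_def by auto
  obtain p where p: "p \<in> Hom C S T" "\<And>i. i < n \<Longrightarrow> p \<cdot> k i = l i"
    by (rule coproduct_copair[OF k T, of l]) (auto intro: coproduct_inj[OF l])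
  obtain q where q: "q \<in> Hom C T S" "\<And>i. i < n \<Longrightarrow> q \<cdot> l i = k i"
    by (rule coproduct_copair[OF l S, of k]) (auto intro: coproduct_inj[OF k])
  have "q \<cdot> p = Id C S"
    by (rule coproduct_eqI[OF k comp_Hom[OF p(1) q(1)] Id_Hom[OF S]])
       (simp add: p(2) q(2) comp_assoc[OF coproduct_inj[OF k] p(1) q(1)] comp_Id_left[OF coproduct_inj[OF k]])
  moreover have "p \<cdot> q = Id C T"
    by (rule coproduct_eqI[OF l comp_Hom[OF q(1) p(1)] Id_Hom[OF T]])
       (simp add: p(2) q(2) comp_assoc[OF coproduct_inj[OF l] q(1) p(1)] comp_Id_left[OF coproduct_inj[OF l]])
  ultimately show ?thesis using that p q by blast
qed

lemma all_less_2: "(\<forall>i<2. Q i) \<longleftrightarrow> Q 0 \<and> Q (Suc 0)"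
  by (auto simp: less_2_cases_iff)

text \<open>Half of the associativity of coproducts, with the first \<open>n\<close> summands
  bracketed into \<open>Z 0\<close>: mediating arrows are formed through \<open>m\<close> and then
  through \<open>l\<close>. Working with arbitrary cocones instead of the chosen ones avoids
  comparison isomorphisms.\<close>

lemma coproduct_Suc_join:
  assumes m: "is_coproduct C n Y T m" and l: "is_coproduct C 2 Z X l" and T: "Z 0 = T"
  shows "is_coproduct C (Suc n) (\<lambda>i. if i < n then Y i else Z (Suc 0)) X
    (\<lambda>i. if i < n then l 0 \<cdot> m i else l (Suc 0))"
proof (rule is_coproductI)
  have l0: "l 0 \<in> Hom C T X" and l1: "l (Suc 0) \<in> Hom C (Z (Suc 0)) X"
    using coproduct_inj[OF l, of 0] coproduct_inj[OF l, of "Suc 0"] T by auto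
  note lm = comp_Hom[OF coproduct_inj[OF m] l0]
  show "X \<in> Obj C" using Hom_Obj[OF l0] by simp
  show "(if i < n then l 0 \<cdot> m i else l (Suc 0)) \<in> Hom C (if i < n then Y i else Z (Suc 0)) X" for i
    using lm l1 by simp
  {
    fix V f assume V: "V \<in> Obj C"
      and f: "\<And>i. i < Suc n \<Longrightarrow> f i \<in> Hom C (if i < n then Y i else Z (Suc 0)) V"
    have fY: "f i \<in> Hom C (Y i) V" if "i < n" for i using f[of i] that by simp
    obtain g where g: "g \<in> Hom C T V" "\<And>i. i < n \<Longrightarrow> g \<cdot> m i = f i"
      by (rule coproduct_copair[OF m V, of f]) (use fY in blast)+
    have gf: "(if i = 0 then g else f n) \<in> Hom C (Z i) V" if "i < 2" for i
      using that g f[of n] T by (auto simp: less_2_cases_iff)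
    obtain h where h: "h \<in> Hom C X V" "\<And>i. i < 2 \<Longrightarrow> h \<cdot> l i = (if i = 0 then g else f n)"
      by (rule coproduct_copair[OF l V, of "\<lambda>i. if i = 0 then g else f n"]) (use gf in blast)+
    have "h \<cdot> (if i < n then l 0 \<cdot> m i else l (Suc 0)) = f i" if "i < Suc n" for i
      using that[unfolded less_Suc_eq] h(2)[of 0] h(2)[of "Suc 0"] g(2)[of i]
        comp_assoc[OF coproduct_inj[OF m, of i] l0 h(1)] by auto
    with h(1) show "\<exists>h\<in>Hom C X V. \<forall>i<Suc n. h \<cdot> (if i < n then l 0 \<cdot> m i else l (Suc 0)) = f i" by blast
  next
    fix V h h' assume h: "h \<in> Hom C X V" "h' \<in> Hom C X V"
      and eq: "\<And>i. i < Suc n \<Longrightarrow> h \<cdot> (if i < n then l 0 \<cdot> m i else l (Suc 0)) =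
        h' \<cdot> (if i < n then l 0 \<cdot> m i else l (Suc 0))"
    have "h \<cdot> l 0 = h' \<cdot> l 0"
    proof (rule coproduct_eqI[OF m comp_Hom[OF l0 h(1)] comp_Hom[OF l0 h(2)]])
      fix i assume i: "i < n"
      then show "h \<cdot> l 0 \<cdot> m i = h' \<cdot> l 0 \<cdot> m i"
        using eq[of i] comp_assoc[OF coproduct_inj[OF m i] l0 h(1)]
          comp_assoc[OF coproduct_inj[OF m i] l0 h(2)] by simp
    qed
    then show "h = h'" using coproduct_eqI[OF l h] eq[of n] by (auto simp: less_2_cases_iff)
  }
qed

text \<open>The converse bracketing. The arrow \<open>s\<close> is induced by the first
  \<open>n\<close> injections into \<open>S\<close>; a binary cocone is unfolded along
  \<open>l\<close> to an (n+1)-fold one, whose mediating arrow works for both.\<close>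

lemma coproduct_Suc_split:
  assumes k: "is_coproduct C (Suc n) Z S k" and l: "is_coproduct C n Z T l"
  obtains s where "s \<in> Hom C T S" "\<And>i. i < n \<Longrightarrow> s \<cdot> l i = k i"
    "is_coproduct C 2 (pair T (Z n)) S (pair s (k n))"
proof -
  have S: "S \<in> Obj C" and T: "T \<in> Obj C" using k l unfolding is_coproduct_def by auto
  obtain s where s: "s \<in> Hom C T S" "\<And>i. i < n \<Longrightarrow> s \<cdot> l i = k i"
    by (rule coproduct_copair[OF l S, of k]) (auto intro: coproduct_inj[OF k])
  have "is_coproduct C 2 (pair T (Z n)) S (pair s (k n))"
  proof (rule is_coproductI)
    show "pair s (k n) i \<in> Hom C (pair T (Z n) i) S" if "i < 2" for i
      using that s coproduct_inj[OF k, of n] by (auto simp: pair_def)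
  next
    fix V f assume V: "V \<in> Obj C" and f: "\<And>i. i < 2 \<Longrightarrow> f i \<in> Hom C (pair T (Z n) i) V"
    have f0: "f 0 \<in> Hom C T V" and f1: "f (Suc 0) \<in> Hom C (Z n) V"
      using f[of 0] f[of "Suc 0"] by (simp_all add: pair_def)
    have fl: "(if i < n then f 0 \<cdot> l i else f (Suc 0)) \<in> Hom C (Z i) V" if "i < Suc n" for i
      using that[unfolded less_Suc_eq] comp_Hom[OF coproduct_inj[OF l] f0] f1 by auto
    obtain h where h: "h \<in> Hom C S V"
      "\<And>i. i < Suc n \<Longrightarrow> h \<cdot> k i = (if i < n then f 0 \<cdot> l i else f (Suc 0))"
      by (rule coproduct_copair[OF k V, of "\<lambda>i. if i < n then f 0 \<cdot> l i else f (Suc 0)"])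
        (use fl in blast)+
    have "h \<cdot> s = f 0"
      by (rule coproduct_eqI[OF l comp_Hom[OF s(1) h(1)] f0])
         (simp add: comp_assoc[OF coproduct_inj[OF l] s(1) h(1)] s(2) h(2))
    then show "\<exists>h\<in>Hom C S V. \<forall>i<2. h \<cdot> pair s (k n) i = f i"
      using h by (auto simp: pair_def all_less_2)
  next
    fix V h h' assume h: "h \<in> Hom C S V" "h' \<in> Hom C S V"
      and eq: "\<And>i. i < 2 \<Longrightarrow> h \<cdot> pair s (k n) i = h' \<cdot> pair s (k n) i"
    have eqs: "h \<cdot> s = h' \<cdot> s" "h \<cdot> k n = h' \<cdot> k n" using eq[of 0] eq[of "Suc 0"] by (auto simp: pair_def)
    show "h = h'"
    proof (rule coproduct_eqI[OF k h])
      fix i assume i: "i < Suc n"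
      show "h \<cdot> k i = h' \<cdot> k i"
      proof (cases "i < n")
        case True
        then show ?thesis
          using comp_assoc[OF coproduct_inj[OF l True] s(1) h(1)]
            comp_assoc[OF coproduct_inj[OF l True] s(1) h(2)] eqs(1) s(2)[OF True] by simp
      next
        case False
        then show ?thesis using i[unfolded less_Suc_eq] eqs(2) by simp
      qed
    qed
  qed fact
  then show ?thesis using that s by blast
qed

end

section \<open>Coproduct functors\<close>

locale coproduct_category = ambient_category C for C :: "('o, 'm) cat" (structure) +
  fixes P :: "nat \<Rightarrow> (nat \<Rightarrow> 'o) \<Rightarrow> 'o" and \<iota> :: "nat \<Rightarrow> (nat \<Rightarrow> 'o) \<Rightarrow> nat \<Rightarrow> 'm"
  assumes finite_coproducts: "finite_coproducts C P \<iota>"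
begin

lemma is_coproduct_P: "X \<in> Obj (power_cat C n) \<Longrightarrow> is_coproduct C n X (P n X) (\<iota> n X)"
  using finite_coproducts unfolding finite_coproducts_def by blast

lemma P_Obj: "X \<in> Obj (power_cat C n) \<Longrightarrow> P n X \<in> Obj C"
  using is_coproduct_P unfolding is_coproduct_def by blast

lemma inj_Hom: "X \<in> Obj (power_cat C n) \<Longrightarrow> i < n \<Longrightarrow> \<iota> n X i \<in> Hom C (X i) (P n X)"
  using coproduct_inj[OF is_coproduct_P] by blast

lemma power_Hom_Obj:
  assumes "f \<in> Hom (power_cat C n) X Y"
  shows "X \<in> Obj (power_cat C n)" "Y \<in> Obj (power_cat C n)"
  using assms unfolding power_Hom power_Obj by (auto dest: Hom_Obj)

text \<open>The arrow part of the functor is a definite description; the universal property of the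
  domain provides existence and uniqueness of the arrow described.\<close>

lemma coprod_func:
  assumes f: "f \<in> Hom (power_cat C n) X Y"
  shows coprod_Hom: "Farr (coprod_func C P \<iota> n) f \<in> Hom C (P n X) (P n Y)"
    and coprod_inj: "i < n \<Longrightarrow> Farr (coprod_func C P \<iota> n) f \<cdot> \<iota> n X i = \<iota> n Y i \<cdot> f i"
proof -
  have X: "X \<in> Obj (power_cat C n)" and Y: "Y \<in> Obj (power_cat C n)"
    using power_Hom_Obj[OF f] by auto
  have "\<iota> n Y i \<cdot> f i \<in> Hom C (X i) (P n Y)" if "i < n" for i
    using f inj_Hom[OF Y that] that unfolding power_Hom by (blast intro: comp_Hom)
  then have "\<exists>!h. h \<in> Hom C (P n X) (P n Y) \<and> (\<forall>i<n. h \<cdot> \<iota> n X i = \<iota> n Y i \<cdot> f i)"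
    using is_coproduct_P[OF X, unfolded is_coproduct_def, THEN conjunct2, THEN conjunct2, rule_format]
      P_Obj[OF Y] by simp
  from theI'[OF this] have "Farr (coprod_func C P \<iota> n) f \<in> Hom C (P n X) (P n Y) \<and>
      (\<forall>i<n. Farr (coprod_func C P \<iota> n) f \<cdot> \<iota> n X i = \<iota> n Y i \<cdot> f i)"
    using f by (simp add: coprod_func_def Let_def Hom_def)
  then show "Farr (coprod_func C P \<iota> n) f \<in> Hom C (P n X) (P n Y)"
    and "i < n \<Longrightarrow> Farr (coprod_func C P \<iota> n) f \<cdot> \<iota> n X i = \<iota> n Y i \<cdot> f i" by blast+
qed

lemma coprod_eqI:
  assumes f: "f \<in> Hom (power_cat C n) X Y" and h: "h \<in> Hom C (P n X) (P n Y)"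
    and eq: "\<And>i. i < n \<Longrightarrow> h \<cdot> \<iota> n X i = \<iota> n Y i \<cdot> f i"
  shows "Farr (coprod_func C P \<iota> n) f = h"
  by (rule coproduct_eqI[OF is_coproduct_P[OF power_Hom_Obj(1)[OF f]] coprod_Hom[OF f] h])
     (simp add: eq coprod_inj[OF f])

lemma is_functor_coprod: "is_functor (power_cat C n) C (coprod_func C P \<iota> n)"
proof (rule is_functorI)
  interpret power: ambient_category "power_cat C n" by unfold_locales (rule category_power)
  fix X assume X: "X \<in> Obj (power_cat C n)"
  then show "Fobj (coprod_func C P \<iota> n) X \<in> Obj C" using P_Obj by (simp add: coprod_func_def)
  have "Farr (coprod_func C P \<iota> n) (Id (power_cat C n) X) = Id C (P n X)"
    by (rule coprod_eqI[OF power.Id_Hom[OF X] Id_Hom[OF P_Obj[OF X]]])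
       (simp add: power_Id comp_Id_left[OF inj_Hom[OF X]] comp_Id_right[OF inj_Hom[OF X]])
  then show "Farr (coprod_func C P \<iota> n) (Id (power_cat C n) X) = Id C (Fobj (coprod_func C P \<iota> n) X)"
    by (simp add: coprod_func_def)
next
  fix f X Y assume "f \<in> Hom (power_cat C n) X Y"
  then show "Farr (coprod_func C P \<iota> n) f \<in>
      Hom C (Fobj (coprod_func C P \<iota> n) X) (Fobj (coprod_func C P \<iota> n) Y)"
    using coprod_Hom by (simp add: coprod_func_def)
next
  interpret power: ambient_category "power_cat C n" by unfold_locales (rule category_power)
  fix f g X Y Z assume f: "f \<in> Hom (power_cat C n) X Y" and g: "g \<in> Hom (power_cat C n) Y Z"
  note X = power_Hom_Obj(1)[OF f] and Y = power_Hom_Obj(2)[OF f] and Z = power_Hom_Obj(2)[OF g]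
  show "Farr (coprod_func C P \<iota> n) (g \<cdot>\<^bsub>power_cat C n\<^esub> f) =
      Farr (coprod_func C P \<iota> n) g \<cdot> Farr (coprod_func C P \<iota> n) f"
  proof (rule coprod_eqI[OF power.comp_Hom[OF f g] comp_Hom[OF coprod_Hom[OF f] coprod_Hom[OF g]]])
    fix i assume i: "i < n"
    have fi: "f i \<in> Hom C (X i) (Y i)" and gi: "g i \<in> Hom C (Y i) (Z i)"
      using f g i unfolding power_Hom by auto
    show "Farr (coprod_func C P \<iota> n) g \<cdot> Farr (coprod_func C P \<iota> n) f \<cdot> \<iota> n X i =
        \<iota> n Z i \<cdot> (g \<cdot>\<^bsub>power_cat C n\<^esub> f) i"
      using i by (simp add: power_comp coprod_inj[OF f i] coprod_inj[OF g i, symmetric]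
          comp_assoc[OF inj_Hom[OF X i] coprod_Hom[OF f] coprod_Hom[OF g]]
          comp_assoc[OF fi inj_Hom[OF Y i] coprod_Hom[OF g], symmetric]
          comp_assoc[OF fi gi inj_Hom[OF Z i], symmetric])
  qed
qed

section \<open>Binary coproducts and the initial object\<close>

abbreviation plus (infixl "\<oplus>" 65) where "X \<oplus> Y \<equiv> P 2 (pair X Y)"

abbreviation plus_Arr (infixl "\<oplus>\<^sub>A" 65) where
  "f \<oplus>\<^sub>A g \<equiv> Farr (coprod_func C P \<iota> 2) (pair f g)"

abbreviation inl where "inl X Y \<equiv> \<iota> 2 (pair X Y) 0"

abbreviation inr where "inr X Y \<equiv> \<iota> 2 (pair X Y) (Suc 0)"

text \<open>The constant family \<open>undefined\<close> is the only extensional family over the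
  empty index set, hence the only object of the zeroth power; its coproduct is the initial
  object.\<close>

abbreviation zero where "zero \<equiv> P 0 (\<lambda>_. undefined)"

lemma pair_Obj: "X \<in> Obj C \<Longrightarrow> Y \<in> Obj C \<Longrightarrow> pair X Y \<in> Obj (power_cat C 2)"
  by (simp add: power_Obj pair_def)

lemma pair_Hom:
  "f \<in> Hom C X Y \<Longrightarrow> g \<in> Hom C Z W \<Longrightarrow> pair f g \<in> Hom (power_cat C 2) (pair X Z) (pair Y W)"
  by (simp add: power_Hom pair_def)

lemma inl_Hom: "X \<in> Obj C \<Longrightarrow> Y \<in> Obj C \<Longrightarrow> inl X Y \<in> Hom C X (X \<oplus> Y)"
  and inr_Hom: "X \<in> Obj C \<Longrightarrow> Y \<in> Obj C \<Longrightarrow> inr X Y \<in> Hom C Y (X \<oplus> Y)"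
  using inj_Hom[OF pair_Obj, of X Y 0] inj_Hom[OF pair_Obj, of X Y "Suc 0"] by (simp_all add: pair_def)

lemma plus_Hom: "f \<in> Hom C X Y \<Longrightarrow> g \<in> Hom C Z W \<Longrightarrow> f \<oplus>\<^sub>A g \<in> Hom C (X \<oplus> Z) (Y \<oplus> W)"
  by (rule coprod_Hom[OF pair_Hom])

lemma plus_inl: "f \<in> Hom C X Y \<Longrightarrow> g \<in> Hom C Z W \<Longrightarrow> (f \<oplus>\<^sub>A g) \<cdot> inl X Z = inl Y W \<cdot> f"
  and plus_inr: "f \<in> Hom C X Y \<Longrightarrow> g \<in> Hom C Z W \<Longrightarrow> (f \<oplus>\<^sub>A g) \<cdot> inr X Z = inr Y W \<cdot> g"
  using coprod_inj[OF pair_Hom, of f X Y g Z W 0] coprod_inj[OF pair_Hom, of f X Y g Z W "Suc 0"]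
  by (simp_all add: pair_def)

lemma copair:
  assumes f: "f \<in> Hom C X T" and g: "g \<in> Hom C Y T"
  obtains h where "h \<in> Hom C (X \<oplus> Y) T" "h \<cdot> inl X Y = f" "h \<cdot> inr X Y = g"
proof -
  have X: "X \<in> Obj C" and Y: "Y \<in> Obj C" and T: "T \<in> Obj C" using Hom_Obj f g by auto
  have "pair f g i \<in> Hom C (pair X Y i) T" if "i < 2" for i
    using that f g by (auto simp: pair_def)
  then obtain h where "h \<in> Hom C (X \<oplus> Y) T" "\<And>i. i < 2 \<Longrightarrow> h \<cdot> \<iota> 2 (pair X Y) i = pair f g i"
    using coproduct_copair[OF is_coproduct_P[OF pair_Obj[OF X Y]] T, of "pair f g"] by blast
  from that[OF this(1)] this(2)[of 0] this(2)[of "Suc 0"] show ?thesis by (simp add: pair_def)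
qed

lemma plus_eqI:
  assumes "X \<in> Obj C" "Y \<in> Obj C" "h \<in> Hom C (X \<oplus> Y) T" "h' \<in> Hom C (X \<oplus> Y) T"
    and "h \<cdot> inl X Y = h' \<cdot> inl X Y" "h \<cdot> inr X Y = h' \<cdot> inr X Y"
  shows "h = h'"
  by (rule coproduct_eqI[OF is_coproduct_P[OF pair_Obj]]) (use assms in \<open>auto simp: less_2_cases_iff\<close>)

text \<open>Without indices a cocone carries no data, so any \<open>X\<close> and \<open>k\<close>
  may be inserted.\<close>

lemma is_coproduct_zero: "is_coproduct C 0 X zero k"
  by (rule is_coproduct_cong[OF _ _ is_coproduct_P]) (simp_all add: power_Obj)

lemma zero_Obj: "zero \<in> Obj C"
  by (rule P_Obj) (simp add: power_Obj)

lemma zero_arrow: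
  assumes "X \<in> Obj C"
  obtains z where "z \<in> Hom C zero X"
  using coproduct_copair[OF is_coproduct_zero assms] by (metis less_nat_zero_code)

lemma zero_eqI: "f \<in> Hom C zero X \<Longrightarrow> g \<in> Hom C zero X \<Longrightarrow> f = g"
  by (rule coproduct_eqI[OF is_coproduct_zero]) simp_all

end

section \<open>Extensivity for finite families\<close>

lemma prod_Obj: "(X, Y) \<in> Obj (prod_cat C D) \<longleftrightarrow> X \<in> Obj C \<and> Y \<in> Obj D"
  by (simp add: prod_cat_def)

lemma prod_Hom:
  "(f, g) \<in> Hom (prod_cat C D) (X, X') (Y, Y') \<longleftrightarrow> f \<in> Hom C X Y \<and> g \<in> Hom D X' Y'"
  by (auto simp: prod_cat_def Hom_def)

locale extensive_category = coproduct_category +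
  assumes extensive: "extensive C P \<iota>"
begin

text \<open>This is fullness of the slice functor with the triples unpacked: \<open>h\<close> is
  only known to be an arrow over the coproduct of the bases, and extensivity makes it a sum of
  arrows over the summands.\<close>

lemma binary_full:
  assumes f1: "f\<^sub>1 \<in> Hom C X\<^sub>1 Y\<^sub>1" and f2: "f\<^sub>2 \<in> Hom C X\<^sub>2 Y\<^sub>2"
    and g1: "g\<^sub>1 \<in> Hom C Z\<^sub>1 Y\<^sub>1" and g2: "g\<^sub>2 \<in> Hom C Z\<^sub>2 Y\<^sub>2"
    and h: "h \<in> Hom C (X\<^sub>1 \<oplus> X\<^sub>2) (Z\<^sub>1 \<oplus> Z\<^sub>2)" and eq: "(g\<^sub>1 \<oplus>\<^sub>A g\<^sub>2) \<cdot> h = f\<^sub>1 \<oplus>\<^sub>A f\<^sub>2"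
  obtains h\<^sub>1 h\<^sub>2 where "h\<^sub>1 \<in> Hom C X\<^sub>1 Z\<^sub>1" "h\<^sub>2 \<in> Hom C X\<^sub>2 Z\<^sub>2" "h = h\<^sub>1 \<oplus>\<^sub>A h\<^sub>2"
    "g\<^sub>1 \<cdot> h\<^sub>1 = f\<^sub>1" "g\<^sub>2 \<cdot> h\<^sub>2 = f\<^sub>2"
proof -
  let ?S = "prod_cat (slice C Y\<^sub>1) (slice C Y\<^sub>2)" and ?E = "slice_coprod_func C P \<iota>"
  have Y: "Y\<^sub>1 \<in> Obj C" "Y\<^sub>2 \<in> Obj C" using Hom_Obj f1 f2 by auto
  have "fully_faithful ?S (slice C (Y\<^sub>1 \<oplus> Y\<^sub>2)) ?E"
    using extensive Y unfolding extensive_def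
    by (blast intro: equivalence_fully_faithful category_prod category_slice)
  moreover have "(f\<^sub>1, f\<^sub>2) \<in> Obj ?S" "(g\<^sub>1, g\<^sub>2) \<in> Obj ?S"
    using f1 f2 g1 g2 by (auto simp: prod_Obj slice_Obj Hom_def)
  moreover have "(f\<^sub>1 \<oplus>\<^sub>A f\<^sub>2, g\<^sub>1 \<oplus>\<^sub>A g\<^sub>2, h) \<in> Hom (slice C (Y\<^sub>1 \<oplus> Y\<^sub>2)) (Fobj ?E (f\<^sub>1, f\<^sub>2)) (Fobj ?E (g\<^sub>1, g\<^sub>2))"
    using h eq plus_Hom[OF f1 f2] plus_Hom[OF g1 g2]
    by (simp add: slice_Hom slice_coprod_func_def HomD(2)[OF plus_Hom[OF f1 f2]] HomD(2)[OF plus_Hom[OF g1 g2]])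
  ultimately obtain t where t: "t \<in> Hom ?S (f\<^sub>1, f\<^sub>2) (g\<^sub>1, g\<^sub>2)"
    and Et: "Farr ?E t = (f\<^sub>1 \<oplus>\<^sub>A f\<^sub>2, g\<^sub>1 \<oplus>\<^sub>A g\<^sub>2, h)"
    by (rule fully_faithful_surj)
  obtain t1 t2 where t12: "t = (t1, t2)" by (cases t)
  from t obtain h1 h2 where "h1 \<in> Hom C X\<^sub>1 Z\<^sub>1" "h2 \<in> Hom C X\<^sub>2 Z\<^sub>2" "g\<^sub>1 \<cdot> h1 = f\<^sub>1" "g\<^sub>2 \<cdot> h2 = f\<^sub>2"
    "t1 = (f\<^sub>1, g\<^sub>1, h1)" "t2 = (f\<^sub>2, g\<^sub>2, h2)"
    unfolding t12 prod_Hom slice_Hom HomD(2)[OF f1] HomD(2)[OF f2] HomD(2)[OF g1] HomD(2)[OF g2] by auto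
  moreover from this have "h = h1 \<oplus>\<^sub>A h2" using Et by (simp add: t12 slice_coprod_func_def)
  ultimately show ?thesis using that by blast
qed

text \<open>Essential surjectivity of the slice functor, applied to \<open>g\<close> as an object of
  the slice over the coproduct; \<open>p\<close> and \<open>q\<close> are the underlying arrows of
  the resulting slice isomorphism.\<close>

lemma binary_decompose_plus:
  assumes Y: "Y\<^sub>1 \<in> Obj C" "Y\<^sub>2 \<in> Obj C" and g: "g \<in> Hom C X (Y\<^sub>1 \<oplus> Y\<^sub>2)"
  obtains X\<^sub>1 X\<^sub>2 f\<^sub>1 f\<^sub>2 p q where "f\<^sub>1 \<in> Hom C X\<^sub>1 Y\<^sub>1" "f\<^sub>2 \<in> Hom C X\<^sub>2 Y\<^sub>2"
    "p \<in> Hom C (X\<^sub>1 \<oplus> X\<^sub>2) X" "q \<in> Hom C X (X\<^sub>1 \<oplus> X\<^sub>2)"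
    "q \<cdot> p = Id C (X\<^sub>1 \<oplus> X\<^sub>2)" "p \<cdot> q = Id C X" "g \<cdot> p = f\<^sub>1 \<oplus>\<^sub>A f\<^sub>2"
proof -
  let ?S = "prod_cat (slice C Y\<^sub>1) (slice C Y\<^sub>2)" and ?E = "slice_coprod_func C P \<iota>"
    and ?T = "slice C (Y\<^sub>1 \<oplus> Y\<^sub>2)"
  interpret T: ambient_category ?T by unfold_locales (rule category_slice)
  have "essentially_surjective ?S ?T ?E"
    using extensive Y unfolding extensive_def by (blast intro: equivalence_essentially_surjective)
  moreover have "g \<in> Obj ?T" using g by (simp add: slice_Obj HomD(2)[OF g])
  ultimately obtain f e where f: "f \<in> Obj ?S" and e: "e \<in> Hom ?T (Fobj ?E f) g" and iso: "iso ?T e"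
    unfolding essentially_surjective_def by blast
  obtain f1 f2 where f12: "f = (f1, f2)" by (cases f)
  define X1 X2 where "X1 = Dom C f1" and "X2 = Dom C f2"
  have f1: "f1 \<in> Hom C X1 Y\<^sub>1" and f2: "f2 \<in> Hom C X2 Y\<^sub>2"
    using f unfolding f12 prod_Obj slice_Obj X1_def X2_def by auto
  have Ef: "Fobj ?E f = f1 \<oplus>\<^sub>A f2" "Dom C (f1 \<oplus>\<^sub>A f2) = X1 \<oplus> X2"
    using plus_Hom[OF f1 f2] by (auto simp: f12 slice_coprod_func_def Hom_def)
  obtain e' where e': "e' \<in> Hom ?T g (Fobj ?E f)" "e' \<cdot>\<^bsub>?T\<^esub> e = Id ?T (Fobj ?E f)" "e \<cdot>\<^bsub>?T\<^esub> e' = Id ?T g"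
    using T.isoE[OF iso e] by blast
  obtain p where p: "p \<in> Hom C (X1 \<oplus> X2) X" "e = (f1 \<oplus>\<^sub>A f2, g, p)" "g \<cdot> p = f1 \<oplus>\<^sub>A f2"
    using e unfolding slice_Hom Ef HomD(2)[OF g] by blast
  obtain q where q: "q \<in> Hom C X (X1 \<oplus> X2)" "e' = (g, f1 \<oplus>\<^sub>A f2, q)"
    using e'(1) unfolding slice_Hom Ef HomD(2)[OF g] by blast
  have "q \<cdot> p = Id C (X1 \<oplus> X2)" "p \<cdot> q = Id C X"
    using e'(2,3) unfolding Ef p(2) q(2) by (simp_all add: slice_def Ef HomD(2)[OF g])
  with that f1 f2 p q show ?thesis by blast
qed

text \<open>Padding with an arrow \<open>z\<close> out of \<open>zero\<close> makes
  \<open>u \<oplus>\<^sub>A z\<close> and \<open>v \<oplus>\<^sub>A z\<close> equal, so the identity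
  of \<open>T \<oplus> zero\<close> is an arrow between them over the base. By fullness it splits as
  a sum whose left part \<open>h\<close> satisfies \<open>v \<cdot> h = u\<close>, and
  \<open>h\<close> must be the identity.\<close>

lemma inl_monic:
  assumes X: "X \<in> Obj C" and Y: "Y \<in> Obj C" and u: "u \<in> Hom C T X" and v: "v \<in> Hom C T X"
    and eq: "inl X Y \<cdot> u = inl X Y \<cdot> v"
  shows "u = v"
proof -
  have T: "T \<in> Obj C" using Hom_Obj[OF u] by simp
  obtain z where z: "z \<in> Hom C zero Y" by (rule zero_arrow[OF Y])
  obtain t where t: "t \<in> Hom C zero T" by (rule zero_arrow[OF T])
  have TZ: "T \<oplus> zero \<in> Obj C" by (rule P_Obj[OF pair_Obj[OF T zero_Obj]])
  have "u \<oplus>\<^sub>A z = v \<oplus>\<^sub>A z"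
    by (rule plus_eqI[OF T zero_Obj plus_Hom[OF u z] plus_Hom[OF v z]])
       (simp_all add: plus_inl[OF u z] plus_inl[OF v z] plus_inr[OF u z] plus_inr[OF v z] eq)
  then have "(v \<oplus>\<^sub>A z) \<cdot> Id C (T \<oplus> zero) = u \<oplus>\<^sub>A z" by (simp add: comp_Id_right[OF plus_Hom[OF v z]])
  then obtain h k where h: "h \<in> Hom C T T" and k: "k \<in> Hom C zero zero"
    and hk: "Id C (T \<oplus> zero) = h \<oplus>\<^sub>A k" and vh: "v \<cdot> h = u"
    by (rule binary_full[OF u z v z Id_Hom[OF TZ]])
  \<comment> \<open>The padding makes \<open>inl T zero\<close> a split monomorphism: its retraction
    is the identity on \<open>T\<close> and the arrow \<open>t\<close> on \<open>zero\<close>. For a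
    general second summand there need be no arrow to \<open>T\<close>.\<close>
  obtain r where r: "r \<in> Hom C (T \<oplus> zero) T" "r \<cdot> inl T zero = Id C T"
    by (rule copair[OF Id_Hom[OF T] t])
  note inl = inl_Hom[OF T zero_Obj]
  have "inl T zero \<cdot> h = inl T zero"
    using plus_inl[OF h k] comp_Id_left[OF inl] by (simp add: hk)
  then have "h = Id C T"
    using section_cancel[OF inl r h Id_Hom[OF T]] comp_Id_right[OF inl] by simp
  then show ?thesis using vh comp_Id_right[OF v] by simp
qed

text \<open>Existence part of the pullback property. The arrow \<open>u\<close> is extended to
  \<open>h\<close> on \<open>T \<oplus> zero\<close>, where it lies over
  \<open>v \<oplus>\<^sub>A z\<close>; fullness splits \<open>h\<close>, and its left part is the
  required factorisation.\<close>

lemma inl_cartesian: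
  assumes f: "f \<in> Hom C Y Z" and g: "g \<in> Hom C Y' Z'"
    and u: "u \<in> Hom C T (Y \<oplus> Y')" and v: "v \<in> Hom C T Z" and eq: "(f \<oplus>\<^sub>A g) \<cdot> u = inl Z Z' \<cdot> v"
  obtains w where "w \<in> Hom C T Y" "inl Y Y' \<cdot> w = u" "f \<cdot> w = v"
proof -
  have T: "T \<in> Obj C" and Z': "Z' \<in> Obj C" and YY': "Y \<oplus> Y' \<in> Obj C" using Hom_Obj u g by auto
  obtain z where z: "z \<in> Hom C zero Z'" by (rule zero_arrow[OF Z'])
  obtain y where y: "y \<in> Hom C zero (Y \<oplus> Y')" by (rule zero_arrow[OF YY'])
  obtain h where h: "h \<in> Hom C (T \<oplus> zero) (Y \<oplus> Y')" and h_inl: "h \<cdot> inl T zero = u"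
    by (rule copair[OF u y])
  note fg = plus_Hom[OF f g] and inl = inl_Hom[OF T zero_Obj] and inr = inr_Hom[OF T zero_Obj]
  have "(f \<oplus>\<^sub>A g) \<cdot> h = v \<oplus>\<^sub>A z"
  proof (rule plus_eqI[OF T zero_Obj comp_Hom[OF h fg] plus_Hom[OF v z]])
    show "(f \<oplus>\<^sub>A g) \<cdot> h \<cdot> inl T zero = (v \<oplus>\<^sub>A z) \<cdot> inl T zero"
      by (simp add: comp_assoc[OF inl h fg] h_inl eq plus_inl[OF v z])
    show "(f \<oplus>\<^sub>A g) \<cdot> h \<cdot> inr T zero = (v \<oplus>\<^sub>A z) \<cdot> inr T zero"
      by (rule zero_eqI[OF comp_Hom[OF inr comp_Hom[OF h fg]] comp_Hom[OF inr plus_Hom[OF v z]]])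
  qed
  then obtain w k where w: "w \<in> Hom C T Y" and k: "k \<in> Hom C zero Y'" and "h = w \<oplus>\<^sub>A k" "f \<cdot> w = v"
    by (rule binary_full[OF v z f g h])
  then show ?thesis using that plus_inl[OF w k] h_inl by simp
qed

text \<open>Strictness of the initial object: the inclusions \<open>inl\<close> and \<open>inr\<close> of \<open>X\<close> into
  \<open>X \<oplus> X\<close> lie over the equal inclusions of \<open>zero\<close>, so by the pullback property they coincide,
  which makes parallel arrows out of \<open>X\<close> equal.\<close>

lemma strict_zero:
  assumes g: "g \<in> Hom C X zero" and a: "a \<in> Hom C X T" and b: "b \<in> Hom C X T"
  shows "a = b"
proof -
  have X: "X \<in> Obj C" using Hom_Obj[OF g] by simp
  note inl = inl_Hom[OF X X] and inr = inr_Hom[OF X X]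
  have "inl zero zero = inr zero zero"
    by (rule zero_eqI[OF inl_Hom[OF zero_Obj zero_Obj] inr_Hom[OF zero_Obj zero_Obj]])
  then have "(g \<oplus>\<^sub>A g) \<cdot> inr X X = inl zero zero \<cdot> g" by (simp add: plus_inr[OF g g])
  then obtain w where w: "w \<in> Hom C X X" and inl_w: "inl X X \<cdot> w = inr X X"
    by (rule inl_cartesian[OF g g inr g])
  \<comment> \<open>Copairing turns the equation \<open>inl_w\<close> into the statement that
    precomposing any arrow with \<open>w\<close> yields every arrow parallel to it. Taking both
    arrows equal to \<open>a\<close> shows that \<open>w\<close> acts as an identity on
    \<open>a\<close>.\<close>
  have absorb: "b' = a' \<cdot> w" if a': "a' \<in> Hom C X V" and b': "b' \<in> Hom C X V" for a' b' V
  proof -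
    obtain h where h: "h \<in> Hom C (X \<oplus> X) V" "h \<cdot> inl X X = a'" "h \<cdot> inr X X = b'"
      by (rule copair[OF a' b'])
    then show ?thesis using comp_assoc[OF w inl h(1)] inl_w by simp
  qed
  show ?thesis using absorb[OF a b] absorb[OF a a] by simp
qed

text \<open>The arrow \<open>e\<close> sends summand \<open>i\<close> to the left copy and every
  other summand to its place in the right copy; folding the two copies back by \<open>r\<close>
  undoes this. The right copy contains a redundant \<open>X i\<close>, which is harmless as only a
  split monomorphism is wanted.\<close>

lemma inj_split:
  assumes X: "X \<in> Obj (power_cat C n)" and i: "i < n"
  obtains e r where "e \<in> Hom C (P n X) (X i \<oplus> P n X)" "r \<in> Hom C (X i \<oplus> P n X) (P n X)"
    "r \<cdot> e = Id C (P n X)" "e \<cdot> \<iota> n X i = inl (X i) (P n X)"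
    "\<And>j. j < n \<Longrightarrow> j \<noteq> i \<Longrightarrow> e \<cdot> \<iota> n X j = inr (X i) (P n X) \<cdot> \<iota> n X j"
proof -
  note inj = inj_Hom[OF X] and PX = P_Obj[OF X]
  have Xi: "X i \<in> Obj C" using X i by (simp add: power_Obj)
  note inl = inl_Hom[OF Xi PX] and inr = inr_Hom[OF Xi PX]
  let ?e = "\<lambda>j. if j = i then inl (X i) (P n X) else inr (X i) (P n X) \<cdot> \<iota> n X j"
  have "?e j \<in> Hom C (X j) (X i \<oplus> P n X)" if "j < n" for j
    using inl comp_Hom[OF inj[OF that] inr] by simp
  then obtain e where e: "e \<in> Hom C (P n X) (X i \<oplus> P n X)" and e_inj: "\<And>j. j < n \<Longrightarrow> e \<cdot> \<iota> n X j = ?e j"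
    using coproduct_copair[OF is_coproduct_P[OF X] Hom_Obj(2)[OF inl], of ?e] by blast
  obtain r where r: "r \<in> Hom C (X i \<oplus> P n X) (P n X)" "r \<cdot> inl (X i) (P n X) = \<iota> n X i"
    "r \<cdot> inr (X i) (P n X) = Id C (P n X)"
    by (rule copair[OF inj[OF i] Id_Hom[OF PX]])
  have "r \<cdot> e = Id C (P n X)"
  proof (rule coproduct_eqI[OF is_coproduct_P[OF X] comp_Hom[OF e r(1)] Id_Hom[OF PX]])
    fix j assume j: "j < n"
    show "r \<cdot> e \<cdot> \<iota> n X j = Id C (P n X) \<cdot> \<iota> n X j"
      using r(2,3) comp_assoc[OF inj[OF j] inr r(1)]
      by (simp add: comp_assoc[OF inj[OF j] e r(1)] e_inj[OF j] comp_Id_left[OF inj[OF j]])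
  qed
  then show ?thesis using that[OF e r(1)] e_inj i by simp
qed

text \<open>Composing with \<open>e\<close> turns the i-th injection into \<open>inl\<close>, which
  is already known to be monic.\<close>

lemma inj_monic:
  assumes X: "X \<in> Obj (power_cat C n)" and i: "i < n"
    and u: "u \<in> Hom C T (X i)" and v: "v \<in> Hom C T (X i)" and eq: "\<iota> n X i \<cdot> u = \<iota> n X i \<cdot> v"
  shows "u = v"
proof -
  obtain e r where e: "e \<in> Hom C (P n X) (X i \<oplus> P n X)" "e \<cdot> \<iota> n X i = inl (X i) (P n X)"
    by (rule inj_split[OF X i])
  have "inl (X i) (P n X) \<cdot> u = inl (X i) (P n X) \<cdot> v"
    unfolding e(2)[symmetric] comp_assoc[OF u inj_Hom[OF X i] e(1)] comp_assoc[OF v inj_Hom[OF X i] e(1)] eq ..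
  then show ?thesis by (rule inl_monic[OF Hom_Obj(2)[OF u] P_Obj[OF X] u v])
qed

text \<open>The doubling arrows \<open>e\<close> and \<open>d\<close> for \<open>Y\<close> and
  \<open>Z\<close> form a natural square, so the problem moves to the left summand of
  \<open>Y i \<oplus> P n Y\<close>, where the binary pullback property applies to
  \<open>e \<cdot> u\<close>. The split monomorphism \<open>e\<close> is cancelled at the
  end.\<close>

lemma inj_cartesian:
  assumes f: "f \<in> Hom (power_cat C n) Y Z" and i: "i < n"
    and u: "u \<in> Hom C T (P n Y)" and v: "v \<in> Hom C T (Z i)"
    and eq: "Farr (coprod_func C P \<iota> n) f \<cdot> u = \<iota> n Z i \<cdot> v"
  obtains w where "w \<in> Hom C T (Y i)" "\<iota> n Y i \<cdot> w = u" "f i \<cdot> w = v"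
proof -
  let ?f = "Farr (coprod_func C P \<iota> n) f"
  note Y = power_Hom_Obj(1)[OF f] and Z = power_Hom_Obj(2)[OF f] and Pf = coprod_Hom[OF f]
  note injY = inj_Hom[OF Y] and injZ = inj_Hom[OF Z]
  have fj: "f j \<in> Hom C (Y j) (Z j)" if "j < n" for j using f that by (simp add: power_Hom)
  note fP = plus_Hom[OF fj[OF i] Pf]
  obtain e r where e: "e \<in> Hom C (P n Y) (Y i \<oplus> P n Y)" and r: "r \<in> Hom C (Y i \<oplus> P n Y) (P n Y)"
    and re: "r \<cdot> e = Id C (P n Y)" and e_i: "e \<cdot> \<iota> n Y i = inl (Y i) (P n Y)"
    and e_j: "\<And>j. j < n \<Longrightarrow> j \<noteq> i \<Longrightarrow> e \<cdot> \<iota> n Y j = inr (Y i) (P n Y) \<cdot> \<iota> n Y j"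
    using inj_split[OF Y i] by blast
  obtain d where d: "d \<in> Hom C (P n Z) (Z i \<oplus> P n Z)" and d_i: "d \<cdot> \<iota> n Z i = inl (Z i) (P n Z)"
    and d_j: "\<And>j. j < n \<Longrightarrow> j \<noteq> i \<Longrightarrow> d \<cdot> \<iota> n Z j = inr (Z i) (P n Z) \<cdot> \<iota> n Z j"
    using inj_split[OF Z i] by blast
  have Yi: "Y i \<in> Obj C" and Zi: "Z i \<in> Obj C" using Hom_Obj fj[OF i] by auto
  note inr_Y = inr_Hom[OF Yi P_Obj[OF Y]] and inr_Z = inr_Hom[OF Zi P_Obj[OF Z]]
  \<comment> \<open>Naturality of doubling, tested on injections: summand \<open>i\<close> travels
    through the left copy on both sides, all others through the right copy.\<close>
  have nat: "(f i \<oplus>\<^sub>A ?f) \<cdot> e = d \<cdot> ?f"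
  proof (rule coproduct_eqI[OF is_coproduct_P[OF Y] comp_Hom[OF e fP] comp_Hom[OF Pf d]])
    fix j assume j: "j < n"
    have "(f i \<oplus>\<^sub>A ?f) \<cdot> (e \<cdot> \<iota> n Y j) = d \<cdot> \<iota> n Z j \<cdot> f j"
    proof (cases "j = i")
      case True
      then show ?thesis by (simp add: e_i d_i plus_inl[OF fj[OF i] Pf])
    next
      case False
      have "(f i \<oplus>\<^sub>A ?f) \<cdot> (e \<cdot> \<iota> n Y j) = inr (Z i) (P n Z) \<cdot> ?f \<cdot> \<iota> n Y j"
        unfolding e_j[OF j False] comp_assoc[OF injY[OF j] inr_Y fP, symmetric] plus_inr[OF fj[OF i] Pf] ..
      also have "\<dots> = inr (Z i) (P n Z) \<cdot> \<iota> n Z j \<cdot> f j"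
        unfolding comp_assoc[OF injY[OF j] Pf inr_Z] coprod_inj[OF f j]
        by (rule comp_assoc[OF fj[OF j] injZ[OF j] inr_Z, symmetric])
      finally show ?thesis by (simp add: d_j[OF j False])
    qed
    then show "(f i \<oplus>\<^sub>A ?f) \<cdot> e \<cdot> \<iota> n Y j = d \<cdot> ?f \<cdot> \<iota> n Y j"
      unfolding comp_assoc[OF injY[OF j] e fP] comp_assoc[OF injY[OF j] Pf d] coprod_inj[OF f j]
        comp_assoc[OF fj[OF j] injZ[OF j] d] .
  qed
  have "(f i \<oplus>\<^sub>A ?f) \<cdot> (e \<cdot> u) = inl (Z i) (P n Z) \<cdot> v"
    unfolding comp_assoc[OF u e fP, symmetric] nat comp_assoc[OF u Pf d] eq
      comp_assoc[OF v injZ[OF i] d, symmetric] d_i ..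
  then obtain w where w: "w \<in> Hom C T (Y i)" and "inl (Y i) (P n Y) \<cdot> w = e \<cdot> u" and fw: "f i \<cdot> w = v"
    by (rule inl_cartesian[OF fj[OF i] Pf comp_Hom[OF u e] v])
  then have "e \<cdot> (\<iota> n Y i \<cdot> w) = e \<cdot> u"
    by (simp add: e_i comp_assoc[OF w injY[OF i] e, symmetric])
  then have "\<iota> n Y i \<cdot> w = u"
    by (rule section_cancel[OF e r re comp_Hom[OF w injY[OF i]] u])
  with that w fw show ?thesis by blast
qed

text \<open>Extends the decomposition from the chosen binary coproduct to an arbitrary cocone
  \<open>k\<close>, as needed for the bracketings in the induction: \<open>g\<close> is first
  carried along the comparison isomorphism \<open>t\<close>.\<close>

lemma binary_decompose:
  assumes k: "is_coproduct C 2 Z S k" and g: "g \<in> Hom C X S"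
  obtains Y f m where "is_coproduct C 2 Y X m"
    "\<And>i. i < 2 \<Longrightarrow> f i \<in> Hom C (Y i) (Z i)" "\<And>i. i < 2 \<Longrightarrow> g \<cdot> m i = k i \<cdot> f i"
proof -
  have Z: "Z 0 \<in> Obj C" "Z (Suc 0) \<in> Obj C"
    using Hom_Obj(1)[OF coproduct_inj[OF k]] by auto
  have "is_coproduct C 2 Z (Z 0 \<oplus> Z (Suc 0)) (\<iota> 2 (pair (Z 0) (Z (Suc 0))))"
    by (rule is_coproduct_cong[OF _ _ is_coproduct_P[OF pair_Obj[OF Z]]])
       (auto simp: pair_def less_2_cases_iff)
  then obtain t t' where t: "t \<in> Hom C S (Z 0 \<oplus> Z (Suc 0))" and t': "t' \<in> Hom C (Z 0 \<oplus> Z (Suc 0)) S"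
    and t't: "t' \<cdot> t = Id C S" and tk: "\<And>i. i < 2 \<Longrightarrow> t \<cdot> k i = \<iota> 2 (pair (Z 0) (Z (Suc 0))) i"
    by (rule coproduct_unique_iso[OF k]) blast
  obtain X1 X2 f1 f2 p q where f1: "f1 \<in> Hom C X1 (Z 0)" and f2: "f2 \<in> Hom C X2 (Z (Suc 0))"
    and p: "p \<in> Hom C (X1 \<oplus> X2) X" and q: "q \<in> Hom C X (X1 \<oplus> X2)"
    and qp: "q \<cdot> p = Id C (X1 \<oplus> X2)" and pq: "p \<cdot> q = Id C X" and gp: "t \<cdot> g \<cdot> p = f1 \<oplus>\<^sub>A f2"
    by (rule binary_decompose_plus[OF Z comp_Hom[OF g t]])
  let ?X = "pair X1 X2" and ?f = "pair f1 f2"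
  have X12: "?X \<in> Obj (power_cat C 2)" using pair_Obj Hom_Obj f1 f2 by blast
  note inj = inj_Hom[OF X12]
  have f: "?f i \<in> Hom C (?X i) (Z i)" if "i < 2" for i
    using that f1 f2 by (auto simp: pair_def less_2_cases_iff)
  show ?thesis
  proof (rule that[of ?X "\<lambda>i. p \<cdot> \<iota> 2 ?X i" ?f])
    show "is_coproduct C 2 ?X X (\<lambda>i. p \<cdot> \<iota> 2 ?X i)"
      by (rule is_coproduct_iso[OF is_coproduct_P[OF X12] p q qp pq])
    fix i :: nat assume i: "i < 2"
    show "g \<cdot> (p \<cdot> \<iota> 2 ?X i) = k i \<cdot> ?f i"
    \<comment> \<open>The equation is tested after applying \<open>t\<close>, where the injections
      \<open>k i\<close> become the chosen ones.\<close>
    proof (rule section_cancel[OF t t' t't])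
      show "g \<cdot> (p \<cdot> \<iota> 2 ?X i) \<in> Hom C (?X i) S" by (intro comp_Hom[OF _ g] comp_Hom[OF _ p] inj i)
      show "k i \<cdot> ?f i \<in> Hom C (?X i) S" by (intro comp_Hom[OF f coproduct_inj[OF k]] i)
      have "t \<cdot> (g \<cdot> (p \<cdot> \<iota> 2 ?X i)) = (f1 \<oplus>\<^sub>A f2) \<cdot> \<iota> 2 ?X i"
        unfolding comp_assoc[OF comp_Hom[OF inj[OF i] p] g t, symmetric]
          comp_assoc[OF inj[OF i] p comp_Hom[OF g t], symmetric] gp ..
      also have "\<dots> = t \<cdot> k i \<cdot> ?f i"
        unfolding tk[OF i] by (rule coprod_inj[OF pair_Hom[OF f1 f2] i])
      also have "\<dots> = t \<cdot> (k i \<cdot> ?f i)"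
        by (rule comp_assoc[OF f[OF i] coproduct_inj[OF k i] t])
      finally show "t \<cdot> (g \<cdot> (p \<cdot> \<iota> 2 ?X i)) = t \<cdot> (k i \<cdot> ?f i)" .
    qed
  qed (rule f)
qed

text \<open>Induction on \<open>n\<close>: split the target into its first \<open>n\<close> summands
  and the last one, decompose \<open>g\<close> over this binary coproduct, decompose the left part
  again and rebracket. The family \<open>Z\<close> stays fixed in the induction, because shortening
  the index range does not change the function.\<close>

lemma decompose:
  assumes "is_coproduct C n Z S k" and "g \<in> Hom C X S"
  shows "\<exists>Y f m. is_coproduct C n Y X m \<and>
    (\<forall>i<n. f i \<in> Hom C (Y i) (Z i) \<and> g \<cdot> m i = k i \<cdot> f i)"
  using assms
proof (induction n arbitrary: S k g X)
  case 0
  have S: "S \<in> Obj C" using Hom_Obj[OF 0(2)] by simp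
  obtain s where "s \<in> Hom C S zero"
    using coproduct_copair[OF 0(1) zero_Obj, of k] by auto
  from comp_Hom[OF 0(2) this] obtain x where x: "x \<in> Hom C X zero" by blast
  \<comment> \<open>An arrow into \<open>zero\<close> makes \<open>X\<close> initial: arrows out of
    \<open>X\<close> exist by passing through \<open>zero\<close>, and any two parallel ones agree
    by strictness.\<close>
  have "is_coproduct C 0 Z X k"
  proof (rule is_coproductI)
    show "X \<in> Obj C" using Hom_Obj[OF x] by simp
    fix V assume "V \<in> Obj C"
    then obtain z where z: "z \<in> Hom C zero V" by (rule zero_arrow)
    show "\<exists>h\<in>Hom C X V. \<forall>i<0. h \<cdot> k i = f i" for f using comp_Hom[OF x z] by blast
  qed (use strict_zero[OF x] in auto)
  then show ?case by blast
next
  case (Suc n)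
  \<comment> \<open>Chosen coproducts are specified only for extensional families, so
    \<open>Z\<close> is cut down to the first \<open>n\<close> indices before a coproduct is
    taken.\<close>
  have "restrict Z {..<n} \<in> Obj (power_cat C n)"
    using Hom_Obj(1)[OF coproduct_inj[OF Suc.prems(1)]] by (simp add: power_Obj)
  from is_coproduct_cong[OF _ _ is_coproduct_P[OF this]]
  obtain T l where l: "is_coproduct C n Z T l" by force
  obtain s where s: "s \<in> Hom C T S" "\<And>i. i < n \<Longrightarrow> s \<cdot> l i = k i"
    "is_coproduct C 2 (pair T (Z n)) S (pair s (k n))"
    using coproduct_Suc_split[OF Suc.prems(1) l] by blast
  obtain Y2 f2 m2 where m2: "is_coproduct C 2 Y2 X m2"
    and f2: "\<And>i. i < 2 \<Longrightarrow> f2 i \<in> Hom C (Y2 i) (pair T (Z n) i)"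
    and gm2: "\<And>i. i < 2 \<Longrightarrow> g \<cdot> m2 i = pair s (k n) i \<cdot> f2 i"
    using binary_decompose[OF s(3) Suc.prems(2)] by metis
  have f20: "f2 0 \<in> Hom C (Y2 0) T" and f21: "f2 (Suc 0) \<in> Hom C (Y2 (Suc 0)) (Z n)"
    and gm20: "g \<cdot> m2 0 = s \<cdot> f2 0" and gm21: "g \<cdot> m2 (Suc 0) = k n \<cdot> f2 (Suc 0)"
    using f2[of 0] f2[of "Suc 0"] gm2[of 0] gm2[of "Suc 0"] by (simp_all add: pair_def)
  obtain Y f m where m: "is_coproduct C n Y (Y2 0) m"
    and f: "\<And>i. i < n \<Longrightarrow> f i \<in> Hom C (Y i) (Z i)" and fm: "\<And>i. i < n \<Longrightarrow> f2 0 \<cdot> m i = l i \<cdot> f i"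
    using Suc.IH[OF l f20] by blast
  let ?Y = "\<lambda>i. if i < n then Y i else Y2 (Suc 0)" and ?f = "\<lambda>i. if i < n then f i else f2 (Suc 0)"
    and ?m = "\<lambda>i. if i < n then m2 0 \<cdot> m i else m2 (Suc 0)"
  have cop: "is_coproduct C (Suc n) ?Y X ?m" by (rule coproduct_Suc_join[OF m m2 refl])
  have nat: "?f i \<in> Hom C (?Y i) (Z i) \<and> g \<cdot> ?m i = k i \<cdot> ?f i" if i: "i < Suc n" for i
  proof (cases "i < n")
    case True
    have m20: "m2 0 \<in> Hom C (Y2 0) X" using coproduct_inj[OF m2, of 0] by simp
    note mi = coproduct_inj[OF m True] and li = coproduct_inj[OF l True]
    have "g \<cdot> (m2 0 \<cdot> m i) = s \<cdot> (l i \<cdot> f i)"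
      unfolding comp_assoc[OF mi m20 Suc.prems(2), symmetric] gm20 comp_assoc[OF mi f20 s(1)] fm[OF True] ..
    also have "\<dots> = k i \<cdot> f i"
      unfolding comp_assoc[OF f[OF True] li s(1), symmetric] s(2)[OF True] ..
    finally show ?thesis using True f by simp
  next
    case False
    then show ?thesis using i[unfolded less_Suc_eq] f21 gm21 by simp
  qed
  show ?case
    by (rule exI[of _ ?Y], rule exI[of _ ?f], rule exI[of _ ?m]) (intro conjI[OF cop] allI impI nat)
qed

end

section \<open>The lifting to coalgebras\<close>

context coproduct_category
begin

lemma Fobj_coprod: "Fobj (coprod_func C P \<iota> n) = P n"
  by (simp add: coprod_func_def)

lemma is_functor_diag_coprod:
  assumes H: "is_functor (power_cat C n) (power_cat C n) H"
  shows "is_functor (power_cat C n) (power_cat C n) (H \<circ>\<^sub>F diag_func n \<circ>\<^sub>F coprod_func C P \<iota> n)"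
    and "is_functor C C (coprod_func C P \<iota> n \<circ>\<^sub>F H \<circ>\<^sub>F diag_func n)"
  by (intro is_functor_comp[OF is_functor_coprod] is_functor_comp[OF is_functor_diag]
      is_functor_comp[OF H] is_functor_coprod H)+

text \<open>Coproduct followed by \<open>?G\<close> and \<open>?F\<close> followed by coproduct
  agree on the nose. Hence the coproduct functor sends a coalgebra square to a coalgebra square,
  with no comparison isomorphism in between.\<close>

lemma is_functor_lift:
  assumes H: "is_functor (power_cat C n) (power_cat C n) H"
  shows "is_functor (coalg (power_cat C n) (H \<circ>\<^sub>F diag_func n \<circ>\<^sub>F coprod_func C P \<iota> n))
    (coalg C (coprod_func C P \<iota> n \<circ>\<^sub>F H \<circ>\<^sub>F diag_func n)) (coprod_lift C P \<iota> n)"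
    (is "is_functor (coalg ?D ?F) (coalg C ?G) ?L")
proof -
  interpret power: ambient_category ?D by unfold_locales (rule category_power)
  let ?S = "coprod_func C P \<iota> n"
  note S = is_functor_coprod[of n] and F = is_functor_diag_coprod(1)[OF H] and G = is_functor_diag_coprod(2)[OF H]
  have GF: "Fobj ?G (P n X) = P n (Fobj ?F X)" "Farr ?G (Farr ?S f) = Farr ?S (Farr ?F f)" for X f
    by (simp_all add: comp_func_def Fobj_coprod)
  show ?thesis
  proof (rule is_functorI)
    fix A assume "A \<in> Obj (coalg ?D ?F)"
    then obtain X x where A: "A = (X, x)" and X: "X \<in> Obj ?D" and x: "x \<in> Hom ?D X (Fobj ?F X)"
      by (cases A) (auto simp: power.coalg_Obj)
    show "Fobj ?L A \<in> Obj (coalg C ?G)"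
      using P_Obj[OF X] coprod_Hom[OF x]
      by (simp add: A coprod_lift_def Let_def coalg_Obj GF Fobj_coprod)
    have "Farr ?S (Id ?D X) = Id C (P n X)"
      using functor_Id[OF S X] by (simp add: Fobj_coprod)
    then show "Farr ?L (Id (coalg ?D ?F) A) = Id (coalg C ?G) (Fobj ?L A)"
      by (simp add: A coprod_lift_def coalg_def Let_def Fobj_coprod)
  next
    fix t A B assume t: "t \<in> Hom (coalg ?D ?F) A B"
    obtain X x Y y where AB: "A = (X, x)" "B = (Y, y)" by (cases A; cases B)
    obtain h where x: "x \<in> Hom ?D X (Fobj ?F X)" and y: "y \<in> Hom ?D Y (Fobj ?F Y)"
      and h: "h \<in> Hom ?D X Y" and t': "t = (A, B, h)" and eq: "y \<cdot>\<^bsub>?D\<^esub> h = Farr ?F h \<cdot>\<^bsub>?D\<^esub> x"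
      using t unfolding AB power.coalg_Hom by blast
    have "Farr ?S y \<cdot> Farr ?S h = Farr ?G (Farr ?S h) \<cdot> Farr ?S x"
      unfolding GF functor_comp[OF S h y, symmetric] functor_comp[OF S x functor_Hom[OF F h], symmetric] eq ..
    then show "Farr ?L t \<in> Hom (coalg C ?G) (Fobj ?L A) (Fobj ?L B)"
      using coprod_Hom[OF x] coprod_Hom[OF y] coprod_Hom[OF h]
      by (simp add: AB t' coprod_lift_def Let_def coalg_Hom GF Fobj_coprod)
  next
    fix t u A B V assume t: "t \<in> Hom (coalg ?D ?F) A B" and u: "u \<in> Hom (coalg ?D ?F) B V"
    obtain X x Y y Z z where AB: "A = (X, x)" "B = (Y, y)" "V = (Z, z)" by (cases A; cases B; cases V)
    obtain h k where h: "h \<in> Hom ?D X Y" and k: "k \<in> Hom ?D Y Z" and "t = (A, B, h)" "u = (B, V, k)"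
      using t u unfolding AB power.coalg_Hom by blast
    then show "Farr ?L (u \<cdot>\<^bsub>coalg ?D ?F\<^esub> t) = Farr ?L u \<cdot>\<^bsub>coalg C ?G\<^esub> Farr ?L t"
      using functor_comp[OF S h k] by (simp add: AB coprod_lift_def coalg_def Let_def)
  qed
qed

end

context extensive_category
begin

text \<open>Composing the coproduct of \<open>f\<close> with a source injection gives the component
  of \<open>f\<close> followed by a target injection, and the latter is monic.\<close>

lemma coprod_faithful:
  assumes f: "f \<in> Hom (power_cat C n) X Y" and g: "g \<in> Hom (power_cat C n) X Y"
    and eq: "Farr (coprod_func C P \<iota> n) f = Farr (coprod_func C P \<iota> n) g"
  shows "f = g"
proof (rule power_eqI)
  fix i assume i: "i < n"
  show "f i = g i"
    by (rule inj_monic[OF power_Hom_Obj(2)[OF f] i, of _ "X i"])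
       (use f g i in \<open>auto simp: power_Hom coprod_inj[OF f i, symmetric] coprod_inj[OF g i, symmetric] eq\<close>)
qed (use f g in \<open>auto simp: power_Hom\<close>)

text \<open>The coalgebra situation with \<open>k\<close> in place of H\<Delta>h. What matters about
  \<open>k\<close> is that it is a family of arrows, so the right-hand side of the square preserves
  summands; this forces \<open>h\<close> to preserve them too.\<close>

lemma coprod_full_over:
  assumes x: "x \<in> Hom (power_cat C n) X Z" and y: "y \<in> Hom (power_cat C n) Y W"
    and k: "k \<in> Hom (power_cat C n) Z W" and h: "h \<in> Hom C (P n X) (P n Y)"
    and eq: "Farr (coprod_func C P \<iota> n) y \<cdot> h =
      Farr (coprod_func C P \<iota> n) k \<cdot> Farr (coprod_func C P \<iota> n) x"
  obtains g where "g \<in> Hom (power_cat C n) X Y" "Farr (coprod_func C P \<iota> n) g = h"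
    "y \<cdot>\<^bsub>power_cat C n\<^esub> g = k \<cdot>\<^bsub>power_cat C n\<^esub> x"
proof -
  let ?D = "power_cat C n" and ?S = "Farr (coprod_func C P \<iota> n)"
  interpret power: ambient_category ?D by unfold_locales (rule category_power)
  note X = power_Hom_Obj(1)[OF x] and Y = power_Hom_Obj(1)[OF y]
  note kx = power.comp_Hom[OF x k]
  have Skx: "?S y \<cdot> h = ?S (k \<cdot>\<^bsub>?D\<^esub> x)"
    using eq functor_comp[OF is_functor_coprod x k] by simp
  have "\<exists>w. w \<in> Hom C (X i) (Y i) \<and> \<iota> n Y i \<cdot> w = h \<cdot> \<iota> n X i" if i: "i < n" for i
  proof -
    have "?S y \<cdot> (h \<cdot> \<iota> n X i) = \<iota> n W i \<cdot> (k \<cdot>\<^bsub>?D\<^esub> x) i"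
      unfolding comp_assoc[OF inj_Hom[OF X i] h coprod_Hom[OF y], symmetric] Skx
      by (rule coprod_inj[OF kx i])
    moreover have "(k \<cdot>\<^bsub>?D\<^esub> x) i \<in> Hom C (X i) (W i)" using kx i by (simp add: power_Hom)
    ultimately show ?thesis
      using inj_cartesian[OF y i comp_Hom[OF inj_Hom[OF X i] h]] by metis
  qed
  then obtain w where w: "\<And>i. i < n \<Longrightarrow> w i \<in> Hom C (X i) (Y i)"
    "\<And>i. i < n \<Longrightarrow> \<iota> n Y i \<cdot> w i = h \<cdot> \<iota> n X i" by metis
  have g: "restrict w {..<n} \<in> Hom ?D X Y"
    using w(1) X Y by (simp add: power_Hom power_Obj)
  have Sg: "?S (restrict w {..<n}) = h" by (rule coprod_eqI[OF g h]) (simp add: w(2))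
  \<comment> \<open>The square commutes after taking coproducts, so by faithfulness it commutes in
    the power category.\<close>
  have "y \<cdot>\<^bsub>?D\<^esub> restrict w {..<n} = k \<cdot>\<^bsub>?D\<^esub> x"
    by (rule coprod_faithful[OF power.comp_Hom[OF g y] kx])
       (simp add: functor_comp[OF is_functor_coprod g y] Sg Skx)
  with that g Sg show ?thesis by blast
qed

lemma coprod_lift_fully_faithful:
  assumes H: "is_functor (power_cat C n) (power_cat C n) H"
  shows "fully_faithful (coalg (power_cat C n) (H \<circ>\<^sub>F diag_func n \<circ>\<^sub>F coprod_func C P \<iota> n))
    (coalg C (coprod_func C P \<iota> n \<circ>\<^sub>F H \<circ>\<^sub>F diag_func n)) (coprod_lift C P \<iota> n)"
    (is "fully_faithful (coalg ?D ?F) (coalg C ?G) ?L")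
proof -
  interpret power: ambient_category ?D by unfold_locales (rule category_power)
  let ?S = "coprod_func C P \<iota> n"
  note F = is_functor_diag_coprod(1)[OF H]
  show ?thesis
  proof (rule fully_faithfulI[OF is_functor_lift[OF H]])
    fix A B t u assume tu: "t \<in> Hom (coalg ?D ?F) A B" "u \<in> Hom (coalg ?D ?F) A B"
      and eq: "Farr ?L t = Farr ?L u"
    obtain X x Y y where AB: "A = (X, x)" "B = (Y, y)" by (cases A; cases B)
    obtain h k where h: "h \<in> Hom ?D X Y" and k: "k \<in> Hom ?D X Y" and t: "t = (A, B, h)" "u = (A, B, k)"
      using tu unfolding AB power.coalg_Hom by blast
    show "t = u"
      using coprod_faithful[OF h k] eq by (simp add: t coprod_lift_def Let_def)
  next
    fix A B t assume A: "A \<in> Obj (coalg ?D ?F)" and B: "B \<in> Obj (coalg ?D ?F)"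
      and t: "t \<in> Hom (coalg C ?G) (Fobj ?L A) (Fobj ?L B)"
    obtain X x Y y where AB: "A = (X, x)" "B = (Y, y)" by (cases A; cases B)
    have x: "x \<in> Hom ?D X (Fobj ?F X)" and y: "y \<in> Hom ?D Y (Fobj ?F Y)"
      using A B unfolding AB power.coalg_Obj by auto
    have L: "Fobj ?L A = (P n X, Farr ?S x)" "Fobj ?L B = (P n Y, Farr ?S y)"
      by (simp_all add: AB coprod_lift_def Let_def Fobj_coprod)
    from t obtain h where h: "h \<in> Hom C (P n X) (P n Y)" and t': "t = (Fobj ?L A, Fobj ?L B, h)"
      and eq: "Farr ?S y \<cdot> h = Farr ?G h \<cdot> Farr ?S x"
      unfolding L coalg_Hom by blast
    let ?k = "Farr (H \<circ>\<^sub>F diag_func n) h"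
    have k: "?k \<in> Hom ?D (Fobj ?F X) (Fobj ?F Y)"
      using functor_Hom[OF H functor_Hom[OF is_functor_diag h]]
      by (simp add: comp_func_def Fobj_coprod)
    have "Farr ?S y \<cdot> h = Farr ?S ?k \<cdot> Farr ?S x" using eq by (simp add: comp_func_def)
    then obtain g where g: "g \<in> Hom ?D X Y" and Sg: "Farr ?S g = h" and yg: "y \<cdot>\<^bsub>?D\<^esub> g = ?k \<cdot>\<^bsub>?D\<^esub> x"
      by (rule coprod_full_over[OF x y k h])
    \<comment> \<open>Since the coproduct of \<open>g\<close> is \<open>h\<close>, the family
      \<open>?k\<close> is the value of \<open>?F\<close> at \<open>g\<close>, and the square
      \<open>yg\<close> is the coalgebra square of \<open>g\<close>.\<close>
    have "Farr ?F g = ?k" using Sg by (simp add: comp_func_def)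
    with yg have "(A, B, g) \<in> Hom (coalg ?D ?F) A B"
      using x y g unfolding AB power.coalg_Hom by simp
    moreover have "Farr ?L (A, B, g) = t"
      unfolding t' using Sg by (simp add: coprod_lift_def Let_def)
    ultimately show "\<exists>h\<in>Hom (coalg ?D ?F) A B. Farr ?L h = t" by blast
  qed
qed

lemma coprod_lift_essentially_surjective:
  assumes H: "is_functor (power_cat C n) (power_cat C n) H"
  shows "essentially_surjective (coalg (power_cat C n) (H \<circ>\<^sub>F diag_func n \<circ>\<^sub>F coprod_func C P \<iota> n))
    (coalg C (coprod_func C P \<iota> n \<circ>\<^sub>F H \<circ>\<^sub>F diag_func n)) (coprod_lift C P \<iota> n)"
    (is "essentially_surjective (coalg ?D ?F) (coalg C ?G) ?L")
  unfolding essentially_surjective_def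
proof
  interpret power: ambient_category ?D by unfold_locales (rule category_power)
  let ?S = "coprod_func C P \<iota> n" and ?H = "H \<circ>\<^sub>F diag_func n"
  have H': "is_functor C ?D ?H" by (rule is_functor_comp[OF is_functor_diag H])
  interpret coalg: ambient_category "coalg C ?G"
    by unfold_locales (rule category_coalg[OF is_functor_diag_coprod(2)[OF H]])
  fix A assume "A \<in> Obj (coalg C ?G)"
  then obtain X x where A: "A = (X, x)" and X: "X \<in> Obj C" and x: "x \<in> Hom C X (P n (Fobj ?H X))"
    by (cases A) (auto simp: coalg_Obj comp_func_def Fobj_coprod)
  have Z: "Fobj ?H X \<in> Obj ?D" by (rule functor_Obj[OF H' X])
  obtain Y0 f m where m: "is_coproduct C n Y0 X m"
    and f: "\<And>i. i < n \<Longrightarrow> f i \<in> Hom C (Y0 i) (Fobj ?H X i)"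
    and xm: "\<And>i. i < n \<Longrightarrow> x \<cdot> m i = \<iota> n (Fobj ?H X) i \<cdot> f i"
    using decompose[OF is_coproduct_P[OF Z] x] by blast
  \<comment> \<open>The decomposition delivers families with arbitrary values beyond
    \<open>n\<close>; restricting makes them an object and an arrow of the power category.\<close>
  define Y y' where "Y = restrict Y0 {..<n}" and "y' = restrict f {..<n}"
  have Y: "Y \<in> Obj ?D" using Hom_Obj(1)[OF f] by (simp add: Y_def power_Obj)
  have y': "y' \<in> Hom ?D Y (Fobj ?H X)" using f Z by (simp add: Y_def y'_def power_Hom power_Obj)
  have "is_coproduct C n Y X m" by (rule is_coproduct_cong[OF _ _ m]) (simp_all add: Y_def)
  then obtain p q where p: "p \<in> Hom C (P n Y) X" and q: "q \<in> Hom C X (P n Y)"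
    and qp: "q \<cdot> p = Id C (P n Y)" and pq: "p \<cdot> q = Id C X" and pm: "\<And>i. i < n \<Longrightarrow> p \<cdot> \<iota> n Y i = m i"
    by (rule coproduct_unique_iso[OF is_coproduct_P[OF Y]]) blast
  have xp: "Farr ?S y' = x \<cdot> p"
    by (rule coprod_eqI[OF y' comp_Hom[OF p x]])
       (simp add: comp_assoc[OF inj_Hom[OF Y] p x] pm xm y'_def)
  note Hp = functor_Hom[OF H' p] and Hq = functor_Hom[OF H' q]
  \<comment> \<open>The family \<open>y'\<close> ends in H\<Delta>X, whereas a coalgebra on
    \<open>Y\<close> has to end in H\<Delta> of the coproduct of \<open>Y\<close>; the inverse
    \<open>q\<close> corrects the codomain.\<close>
  define y where "y = Farr ?H q \<cdot>\<^bsub>?D\<^esub> y'"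
  have y: "y \<in> Hom ?D Y (Fobj ?H (P n Y))" unfolding y_def by (rule power.comp_Hom[OF y' Hq])
  have "Farr ?H p \<cdot>\<^bsub>?D\<^esub> Farr ?H q = Id ?D (Fobj ?H X)"
    unfolding functor_comp[OF H' q p, symmetric] pq by (rule functor_Id[OF H' X])
  then have Hp_y: "Farr ?H p \<cdot>\<^bsub>?D\<^esub> y = y'"
    unfolding y_def power.comp_assoc[OF y' Hq Hp, symmetric] by (simp add: power.comp_Id_left[OF y'])
  have p_coalg: "x \<cdot> p = Farr ?S (Farr ?H p) \<cdot> Farr ?S y"
    unfolding functor_comp[OF is_functor_coprod y Hp, symmetric] Hp_y xp ..
  have Sy: "Farr ?S y \<in> Hom C (P n Y) (P n (Fobj ?H (P n Y)))" by (rule coprod_Hom[OF y])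
  have Gp: "Farr ?S (Farr ?H p) \<in> Hom C (P n (Fobj ?H (P n Y))) (P n (Fobj ?H X))"
    by (rule coprod_Hom[OF Hp])
  have Gq: "Farr ?S (Farr ?H q) \<in> Hom C (P n (Fobj ?H X)) (P n (Fobj ?H (P n Y)))"
    by (rule coprod_Hom[OF Hq])
  have "Farr ?S y = Farr ?S (Farr ?H q) \<cdot> (x \<cdot> p)"
    unfolding y_def functor_comp[OF is_functor_coprod y' Hq] xp ..
  \<comment> \<open>An isomorphism of coalgebras needs an inverse that is itself a coalgebra
    morphism; the square for \<open>q\<close> comes from composing the preceding equation with
    \<open>q\<close> on the right.\<close>
  then have q_coalg: "Farr ?S y \<cdot> q = Farr ?S (Farr ?H q) \<cdot> x"
    using comp_assoc[OF q comp_Hom[OF p x] Gq] comp_assoc[OF q p x] pq comp_Id_right[OF x] by simp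
  have YB: "(Y, y) \<in> Obj (coalg ?D ?F)"
    using Y y by (simp add: power.coalg_Obj comp_func_def Fobj_coprod)
  have L: "Fobj ?L (Y, y) = (P n Y, Farr ?S y)"
    by (simp add: coprod_lift_def Let_def Fobj_coprod)
  have G: "Fobj ?G V = P n (Fobj ?H V)" "Farr ?G h = Farr ?S (Farr ?H h)" for V h
    by (simp_all add: comp_func_def Fobj_coprod)
  have e: "((P n Y, Farr ?S y), A, p) \<in> Hom (coalg C ?G) (Fobj ?L (Y, y)) A"
    unfolding A L coalg_Hom G using Sy x p p_coalg by simp
  have d: "(A, (P n Y, Farr ?S y), q) \<in> Hom (coalg C ?G) A (Fobj ?L (Y, y))"
    unfolding A L coalg_Hom G using Sy x q q_coalg by simp
  have "iso (coalg C ?G) ((P n Y, Farr ?S y), A, p)"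
    by (rule coalg.isoI[OF e d]) (simp_all add: L A coalg_def Let_def qp pq)
  with YB e show "\<exists>B\<in>Obj (coalg ?D ?F). \<exists>e\<in>Hom (coalg C ?G) (Fobj ?L B) A. iso (coalg C ?G) e"
    by blast
qed

end

theorem lemma8p17:
  fixes C :: "('o, 'm) cat"
    and P :: "nat \<Rightarrow> (nat \<Rightarrow> 'o) \<Rightarrow> 'o"
    and \<iota> :: "nat \<Rightarrow> (nat \<Rightarrow> 'o) \<Rightarrow> nat \<Rightarrow> 'm"
    and n :: nat
    and H :: "(nat \<Rightarrow> 'o, nat \<Rightarrow> 'm, nat \<Rightarrow> 'o, nat \<Rightarrow> 'm) func"
  assumes "category C"
    and "finitely_complete C"
    and "has_coequalizers C"
    and "finite_coproducts C P \<iota>"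
    and "regular_epis_closed_under_composition C"
    and "is_functor (power_cat C n) (power_cat C n) H"
    and "preserves_monos (power_cat C n) (power_cat C n) H"
    and "extensive C P \<iota>"
  shows "is_equivalence
           (coalg (power_cat C n) (H \<circ>\<^sub>F diag_func n \<circ>\<^sub>F coprod_func C P \<iota> n))
           (coalg C (coprod_func C P \<iota> n \<circ>\<^sub>F H \<circ>\<^sub>F diag_func n))
           (coprod_lift C P \<iota> n)"
proof -
  interpret extensive_category C P \<iota> by unfold_locales fact+
  interpret power: ambient_category "power_cat C n" by unfold_locales (rule category_power)
  note H = \<open>is_functor (power_cat C n) (power_cat C n) H\<close>
  show ?thesis
    by (intro equivalenceI power.category_coalg category_coalg is_functor_diag_coprod is_functor_lift
        coprod_lift_fully_faithful coprod_lift_essentially_surjective H)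
qed

end
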